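(* Let $k\ge 2$, let $p\in\mathbb{C}[x_1,\dots,x_k]\setminus\mathbb{C}$, and let $X=\{uv-p(\bar x)=0\}\subset\mathbb{C}^{k+2}$, with coordinates $(\bar x,u,v)$, $\bar x=(x_1,\dots,x_k)$. Let $\widehat G\subset\mathrm{Aut}\,X$ be the subgroup generated by the two subgroups $\widehat G_1$ and $\widehat G_2$ of lifted automorphisms (defined in the context). Then $\widehat G$ acts $m$-transitively on $X\setminus\mathrm{sing}\,X$ for every $m\in\mathbb{N}$.
   Context: Put $X_0=p^{-1}(0)\subset\mathbb{C}^k$. Let $\sigma_1:X\to\mathbb{C}^{k+1}=\mathbb{C}^k_{\bar x}\times\mathbb{C}_v$, $\sigma_1(\bar x,u,v)=(\bar x,v)$, and $\sigma_2:X\to\mathbb{C}^{k+1}=\mathbb{C}^k_{\bar x}\times\mathbb{C}_u$, $\sigma_2(\bar x,u,v)=(\bar x,u)$. Let $D_v=\{v=0\}\subset\mathbb{C}^k_{\bar x}\times\mathbb{C}_v$ and $D_u=\{u=0\}\subset\mathbb{C}^k_{\bar x}\times\mathbb{C}_u$; each is identified with $\mathbb{C}^k$, so that $X_0$ is regarded as a subvariety of each. Put $V_0=X\cap\{v=0\}$, $U_0=X\cap\{u=0\}$. A $\mathbb{C}_+$-subgroup of an automorphism group is the image of a regular (algebraic) action of the additive group $\mathbb{C}_+$ of complex numbers. $G_1\subset\mathrm{Aut}(\mathbb{C}^k_{\bar x}\times\mathbb{C}_v)$ is the subgroup generated by all $\mathbb{C}_+$-subgroups $T$ such that the function $v$ is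 $T$-invariant and the restriction of $T$ to the invariant hyperplane $D_v$ leaves $X_0$ invariant. $G_2\subset\mathrm{Aut}(\mathbb{C}^k_{\bar x}\times\mathbb{C}_u)$ is defined in the same way with $u$ and $D_u$ in place of $v$ and $D_v$. Each $g\in G_1$ has a unique lift $\widehat g\in\mathrm{Aut}\,X$ which leaves $V_0$ invariant and satisfies $\widehat g=\sigma_1^{-1}\circ g\circ\sigma_1$ on $X\setminus V_0$; $\widehat G_1\subset\mathrm{Aut}\,X$ is the subgroup of all these lifts. $\widehat G_2$ is the group of lifts of elements of $G_2$, defined in the same way using $\sigma_2$ and $U_0$. A group acting on a set $S$ acts $m$-transitively if for any two $m$-tuples of pairwise distinct points of $S$ there is a group element sending the first tuple to the second (in order). *)

theory Defs
  imports
    "HOL-Analysis.Analysis"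
    "HOL-Algebra.Group_Action"
    "HOL-Algebra.Generated_Groups"
begin

(* Polynomials over the infinite field of complex numbers are identified with the polynomial
   functions they induce on complex affine space. *)
inductive polynomial_fun :: "(complex ^ 'n \<Rightarrow> complex) \<Rightarrow> bool" where
  const: "polynomial_fun (\<lambda>z. c)"
| coord: "polynomial_fun (\<lambda>z. z $ i)"
| add: "polynomial_fun f \<Longrightarrow> polynomial_fun g \<Longrightarrow> polynomial_fun (\<lambda>z. f z + g z)"
| mult: "polynomial_fun f \<Longrightarrow> polynomial_fun g \<Longrightarrow> polynomial_fun (\<lambda>z. f z * g z)"

(* Regular maps on a closed subvariety S of affine space: restrictions of polynomial maps. *)
definition regular_map_on ::
    "(complex ^ 'n) set \<Rightarrow> (complex ^ 'n \<Rightarrow> complex ^ 'm) \<Rightarrow> bool" where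
  "regular_map_on S f \<longleftrightarrow>
     (\<exists>F. (\<forall>j. polynomial_fun (\<lambda>z. F z $ j)) \<and> (\<forall>z\<in>S. f z = F z))"

(* The carrier of Aut S, a subset of the group BijGroup S of (extensional) bijections of S. *)
definition Aut :: "(complex ^ 'n) set \<Rightarrow> (complex ^ 'n \<Rightarrow> complex ^ 'n) set" where
  "Aut S = {f \<in> Bij S. regular_map_on S f \<and> regular_map_on S (inv_into S f)}"

(* The vectors killed by the differentials at a of all polynomials vanishing on S. *)
definition zariski_tangent_space ::
    "(complex ^ 'n) set \<Rightarrow> complex ^ 'n \<Rightarrow> (complex ^ 'n) set" where
  "zariski_tangent_space S a =
     {w. \<forall>f. polynomial_fun f \<and> (\<forall>z\<in>S. f z = 0) \<longrightarrow> deriv (\<lambda>t. f (a + t *s w)) 0 = 0}"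

(* For an irreducible variety S: its dimension is the minimal dimension of its tangent spaces,
   and a point is singular if the tangent space there has larger dimension. *)
definition sing :: "(complex ^ 'n) set \<Rightarrow> (complex ^ 'n) set" where
  "sing S = {a \<in> S. \<exists>b\<in>S.
     vec.dim (zariski_tangent_space S b) < vec.dim (zariski_tangent_space S a)}"

(* Affine space of dimension n + r is modelled by the index type 'n + 'r. The coordinates Inl i
   are those of the first factor. *)
definition base :: "complex ^ ('n::finite + 'r::finite) \<Rightarrow> complex ^ 'n" where
  "base z = (\<chi> i. z $ Inl i)"

definition C_plus :: "complex monoid" where
  "C_plus = \<lparr>carrier = UNIV, mult = (+), one = 0\<rparr>"

(* T is the image of an action of the additive group of complex numbers on S which is regular
   jointly in the group parameter (the coordinate Inr 1) and the point of S. *)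
definition C_plus_subgroup ::
    "(complex ^ 'n) set \<Rightarrow> (complex ^ 'n \<Rightarrow> complex ^ 'n) set \<Rightarrow> bool" where
  "C_plus_subgroup S T \<longleftrightarrow>
     (\<exists>\<phi>. group_action C_plus S \<phi> \<and>
          regular_map_on {z :: complex ^ ('n + 1). base z \<in> S} (\<lambda>z. \<phi> (z $ Inr 1) (base z)) \<and>
          T = range \<phi>)"

(* Both groups G_1 and G_2: after naming the last coordinate (v, resp. u) of affine
   (k+1)-space Inr 1, they are literally the same group. *)
definition G_group ::
    "(complex ^ 'k \<Rightarrow> complex) \<Rightarrow> (complex ^ ('k + 1) \<Rightarrow> complex ^ ('k + 1)) set" where
  "G_group p = generate (BijGroup UNIV)
     (\<Union> {T. C_plus_subgroup UNIV T \<and>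
             (\<forall>g\<in>T. \<forall>z. g z $ Inr 1 = z $ Inr 1) \<and>
             (\<forall>g\<in>T. g ` {z. z $ Inr 1 = 0 \<and> p (base z) = 0} = {z. z $ Inr 1 = 0 \<and> p (base z) = 0})})"

(* Coordinates on affine (k+2)-space; 0 and 1 here are the two elements of the type 2. *)
abbreviation coord_u :: "complex ^ ('k::finite + 2) \<Rightarrow> complex" where
  "coord_u z \<equiv> z $ Inr 0"

abbreviation coord_v :: "complex ^ ('k::finite + 2) \<Rightarrow> complex" where
  "coord_v z \<equiv> z $ Inr 1"

definition hypersurface :: "(complex ^ 'k \<Rightarrow> complex) \<Rightarrow> (complex ^ ('k + 2)) set" where
  "hypersurface p = {z. coord_u z * coord_v z - p (base z) = 0}"

definition append_coord :: "complex ^ 'k \<Rightarrow> complex \<Rightarrow> complex ^ ('k + 1)" where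
  "append_coord x t = (\<chi> j. case j of Inl i \<Rightarrow> x $ i | Inr _ \<Rightarrow> t)"

definition \<sigma>\<^sub>1 :: "complex ^ ('k::finite + 2) \<Rightarrow> complex ^ ('k + 1)" where
  "\<sigma>\<^sub>1 z = append_coord (base z) (coord_v z)"

definition \<sigma>\<^sub>2 :: "complex ^ ('k::finite + 2) \<Rightarrow> complex ^ ('k + 1)" where
  "\<sigma>\<^sub>2 z = append_coord (base z) (coord_u z)"

definition V0 :: "(complex ^ 'k \<Rightarrow> complex) \<Rightarrow> (complex ^ ('k + 2)) set" where
  "V0 p = hypersurface p \<inter> {z. coord_v z = 0}"

definition U0 :: "(complex ^ 'k \<Rightarrow> complex) \<Rightarrow> (complex ^ ('k + 2)) set" where
  "U0 p = hypersurface p \<inter> {z. coord_u z = 0}"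

(* h is a lift of g through \<sigma>, which is injective on X - E. *)
definition is_lift ::
    "(complex ^ 'n) set \<Rightarrow> (complex ^ 'n) set \<Rightarrow> (complex ^ 'n \<Rightarrow> complex ^ 'm) \<Rightarrow>
     (complex ^ 'm \<Rightarrow> complex ^ 'm) \<Rightarrow> (complex ^ 'n \<Rightarrow> complex ^ 'n) \<Rightarrow> bool" where
  "is_lift X E \<sigma> g h \<longleftrightarrow>
     h \<in> Aut X \<and> h ` E = E \<and> (\<forall>z \<in> X - E. h z = inv_into (X - E) \<sigma> (g (\<sigma> z)))"

definition G1_hat ::
    "(complex ^ 'k \<Rightarrow> complex) \<Rightarrow> (complex ^ ('k + 2) \<Rightarrow> complex ^ ('k + 2)) set" where
  "G1_hat p = {h. \<exists>g \<in> G_group p. is_lift (hypersurface p) (V0 p) \<sigma>\<^sub>1 g h}"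

definition G2_hat ::
    "(complex ^ 'k \<Rightarrow> complex) \<Rightarrow> (complex ^ ('k + 2) \<Rightarrow> complex ^ ('k + 2)) set" where
  "G2_hat p = {h. \<exists>g \<in> G_group p. is_lift (hypersurface p) (U0 p) \<sigma>\<^sub>2 g h}"

definition G_hat ::
    "(complex ^ 'k \<Rightarrow> complex) \<Rightarrow> (complex ^ ('k + 2) \<Rightarrow> complex ^ ('k + 2)) set" where
  "G_hat p = generate (BijGroup (hypersurface p)) (G1_hat p \<union> G2_hat p)"

(* The first conjunct says that the group G of transformations does act on S. *)
definition acts_m_transitively :: "nat \<Rightarrow> ('a \<Rightarrow> 'a) set \<Rightarrow> 'a set \<Rightarrow> bool" where
  "acts_m_transitively m G S \<longleftrightarrow>
     (\<forall>g\<in>G. bij_betw g S S) \<and>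
     (\<forall>xs ys. length xs = m \<and> length ys = m \<and> distinct xs \<and> distinct ys \<and>
        set xs \<subseteq> S \<and> set ys \<subseteq> S \<longrightarrow> (\<exists>g\<in>G. map g xs = ys))"

end

theory Submission
  imports Defs "HOL-Computational_Algebra.Fundamental_Theorem_Algebra"
begin

text \<open>Points of the hypersurface with \<open>v \<noteq> 0\<close> are determined by \<open>(x, v)\<close>, and the shears
  \<open>(x, v) \<mapsto> (x + v \<Phi>(\<lambda>(x, v)), v)\<close>, where \<open>\<lambda>\<close> is a linear form killing the values of the polynomial
  curve \<open>\<Phi>\<close>, are the identity on \<open>v = 0\<close> and therefore lift. By Lagrange interpolation two such shears
  move any tuple of distinct points with \<open>v \<noteq> 0\<close> to any other one with the same \<open>v\<close>-coordinates.
  Exchanging \<open>u\<close> and \<open>v\<close>, a tuple with all \<open>v\<^sub>j \<noteq> 0\<close> is joined to a tuple with all \<open>u'\<^sub>j \<noteq> 0\<close> through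
  points \<open>(y\<^sub>j, u'\<^sub>j, v\<^sub>j)\<close> with \<open>p(y\<^sub>j) = u'\<^sub>j v\<^sub>j\<close>; these exist because, as \<open>k \<ge> 2\<close>, all fibres of \<open>p\<close> are
  infinite. Finally, at a nonsingular point \<open>u\<close>, \<open>v\<close> and \<open>dp\<close> do not vanish simultaneously, so generic
  shears move any tuple of nonsingular points off \<open>v = 0\<close>, or off \<open>u = 0\<close>.\<close>

section \<open>Polynomial functions and their differentials\<close>

lemma polynomial_fun_uminus:
  assumes "polynomial_fun f"
  shows "polynomial_fun (\<lambda>z. - f z)"
  using polynomial_fun.mult[OF polynomial_fun.const[of "-1"] assms] by simp

lemma polynomial_fun_diff:
  assumes "polynomial_fun f" "polynomial_fun g"
  shows "polynomial_fun (\<lambda>z. f z - g z)"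
  using polynomial_fun.add[OF assms(1) polynomial_fun_uminus[OF assms(2)]] by simp

lemma polynomial_fun_sum:
  assumes "\<And>i. i \<in> I \<Longrightarrow> polynomial_fun (f i)"
  shows "polynomial_fun (\<lambda>z. \<Sum>i\<in>I. f i z)"
  using assms
  by (induction I rule: infinite_finite_induct) (auto intro: polynomial_fun.intros)

lemma polynomial_fun_compose:
  assumes "polynomial_fun f" "\<And>i. polynomial_fun (\<lambda>z. F z $ i)"
  shows "polynomial_fun (\<lambda>z. f (F z))"
  using assms by induction (auto intro: polynomial_fun.intros)

lemma polynomial_fun_poly:
  assumes "polynomial_fun f"
  shows "polynomial_fun (\<lambda>z. poly P (f z))"
  using assms by (induction P) (auto intro: polynomial_fun.intros)

lemma polynomial_fun_curve:
  assumes "polynomial_fun f" "\<And>i. \<exists>P. \<forall>t. c t $ i = poly P t"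
  shows "\<exists>P. \<forall>t. f (c t) = poly P t"
  using assms
proof induction
  case (const c)
  show ?case by (rule exI[of _ "[:c:]"]) simp
next
  case (add f g)
  then obtain P Q where "\<forall>t. f (c t) = poly P t" "\<forall>t. g (c t) = poly Q t" by blast
  then show ?case by (intro exI[of _ "P + Q"]) simp
next
  case (mult f g)
  then obtain P Q where "\<forall>t. f (c t) = poly P t" "\<forall>t. g (c t) = poly Q t" by blast
  then show ?case by (intro exI[of _ "P * Q"]) simp
qed auto

lemma polynomial_fun_line:
  assumes "polynomial_fun f"
  shows "\<exists>P. \<forall>t. f (x + t *s w) = poly P t"
proof (rule polynomial_fun_curve[OF assms])
  fix i
  show "\<exists>P. \<forall>t. (x + t *s w) $ i = poly P t"
    by (rule exI[of _ "[:x $ i, w $ i:]"]) simp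
qed

definition linear_form :: "complex ^ 'n \<Rightarrow> complex ^ 'n \<Rightarrow> complex" where
  "linear_form l z = (\<Sum>i\<in>UNIV. l $ i * z $ i)"

lemma linear_form_add: "linear_form l (x + y) = linear_form l x + linear_form l y"
  by (simp add: linear_form_def distrib_left sum.distrib)

lemma linear_form_scale: "linear_form l (c *s x) = c * linear_form l x"
  by (simp add: linear_form_def sum_distrib_left mult_ac)

lemma linear_form_diff: "linear_form l (x - y) = linear_form l x - linear_form l y"
  by (simp add: linear_form_def right_diff_distrib sum_subtractf)

lemma linear_form_zero: "linear_form l 0 = 0"
  by (simp add: linear_form_def)

lemma linear_form_sum: "linear_form l (\<Sum>i\<in>I. f i) = (\<Sum>i\<in>I. linear_form l (f i))"
  by (induction I rule: infinite_finite_induct) (simp_all add: linear_form_zero linear_form_add)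

lemma linear_form_axis: "linear_form l (axis i 1) = l $ i"
  by (simp add: linear_form_def axis_def if_distrib[of "\<lambda>x. _ * x"] cong: if_cong)

definition gradient :: "(complex ^ 'n \<Rightarrow> complex) \<Rightarrow> complex ^ 'n \<Rightarrow> complex ^ 'n" where
  "gradient f a = (\<chi> i. deriv (\<lambda>t. f (a + t *s axis i 1)) 0)"

lemma line_has_field_derivative:
  "((\<lambda>t. (a + t *s w) $ i) has_field_derivative w $ i) (at (t::complex))"
  by (auto intro!: derivative_eq_intros)

text \<open>Structural induction on \<open>f\<close> yields one covector valid for all curves
  through \<open>a\<close>; testing it on the coordinate lines identifies it with the
  gradient.\<close>

lemma polynomial_fun_chain_rule:
  fixes f :: "complex ^ 'n \<Rightarrow> complex"
  assumes "polynomial_fun f" "c 0 = a"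
    "\<And>i. ((\<lambda>t. c t $ i) has_field_derivative w $ i) (at 0)"
  shows "((\<lambda>t. f (c t)) has_field_derivative linear_form (gradient f a) w) (at 0)"
proof -
  \<comment> \<open>The covector is chosen before \<open>c\<close> and \<open>w\<close>, so that the
    covectors of two factors combine by the Leibniz rule independently of the curve.\<close>
  have "\<exists>g::complex^'n. \<forall>c w. c 0 = a \<longrightarrow>
      (\<forall>i. ((\<lambda>t. c t $ i) has_field_derivative w $ i) (at 0)) \<longrightarrow>
      ((\<lambda>t. f (c t)) has_field_derivative linear_form g w) (at 0)"
    using assms(1)
  proof induction
    case (const c)
    show ?case by (rule exI[of _ 0]) (simp add: linear_form_def)
  next
    case (coord i)
    show ?case
      by (rule exI[of _ "axis i 1"])
        (simp add: linear_form_def axis_def if_distrib[of "\<lambda>x. x * _"] cong: if_cong)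
  next
    case (add f g)
    then obtain u v where
      "\<And>c w. c 0 = a \<Longrightarrow> (\<forall>i. ((\<lambda>t. c t $ i) has_field_derivative w $ i) (at 0)) \<Longrightarrow>
        ((\<lambda>t. f (c t)) has_field_derivative linear_form u w) (at 0)"
      "\<And>c w. c 0 = a \<Longrightarrow> (\<forall>i. ((\<lambda>t. c t $ i) has_field_derivative w $ i) (at 0)) \<Longrightarrow>
        ((\<lambda>t. g (c t)) has_field_derivative linear_form v w) (at 0)"
      by blast
    then show ?case
      by (intro exI[of _ "u + v"])
        (auto simp: linear_form_def distrib_right sum.distrib intro!: DERIV_add)
  next
    case (mult f g)
    then obtain u v where
      u: "\<And>c w. c 0 = a \<Longrightarrow> (\<forall>i. ((\<lambda>t. c t $ i) has_field_derivative w $ i) (at 0)) \<Longrightarrow>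
        ((\<lambda>t. f (c t)) has_field_derivative linear_form u w) (at 0)" and
      v: "\<And>c w. c 0 = a \<Longrightarrow> (\<forall>i. ((\<lambda>t. c t $ i) has_field_derivative w $ i) (at 0)) \<Longrightarrow>
        ((\<lambda>t. g (c t)) has_field_derivative linear_form v w) (at 0)"
      by blast
    show ?case
    proof (intro exI[of _ "g a *s u + f a *s v"] allI impI)
      fix c w
      assume c: "c 0 = a" "\<forall>i. ((\<lambda>t. c t $ i) has_field_derivative w $ i) (at 0)"
      have "linear_form (g a *s u + f a *s v) w =
          linear_form u w * g (c 0) + linear_form v w * f (c 0)"
        by (simp add: c linear_form_def sum_distrib_right sum_distrib_left algebra_simps sum.distrib)
      then show "((\<lambda>t. f (c t) * g (c t)) has_field_derivative
          linear_form (g a *s u + f a *s v) w) (at 0)"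
        using DERIV_mult[OF u[OF c] v[OF c]] by simp
    qed
  qed
  then obtain g where g: "\<forall>c w. c 0 = a \<longrightarrow>
      (\<forall>i. ((\<lambda>t. c t $ i) has_field_derivative w $ i) (at 0)) \<longrightarrow>
      ((\<lambda>t. f (c t)) has_field_derivative linear_form g w) (at 0)" ..
  have "deriv (\<lambda>t. f (a + t *s axis i 1)) 0 = linear_form g (axis i 1)" for i
    by (rule DERIV_imp_deriv, rule g[rule_format]) (simp, rule line_has_field_derivative)
  then have "gradient f a = g"
    by (simp add: gradient_def linear_form_axis)
  then show ?thesis using g assms(2,3) by simp
qed

lemma polynomial_fun_line_derivative:
  assumes "polynomial_fun f"
  shows "((\<lambda>t. f (a + t *s w)) has_field_derivative linear_form (gradient f a) w) (at 0)"
  by (rule polynomial_fun_chain_rule[OF assms]) (simp, rule line_has_field_derivative)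

lemma deriv_line:
  assumes "polynomial_fun f"
  shows "deriv (\<lambda>t. f (a + t *s w)) 0 = linear_form (gradient f a) w"
  by (rule DERIV_imp_deriv, rule polynomial_fun_line_derivative[OF assms])

section \<open>Difference quotients of polynomials\<close>

text \<open>The continuation across \<open>s = 0\<close> is what lets a lift be defined on the
  divisor. With \<open>s = v\<close>, and \<open>u = p x / v\<close> off the divisor, the value is
  the change of \<open>u\<close> when \<open>x\<close> moves to \<open>x + v *s a\<close>.\<close>

definition difference_quotient ::
    "(complex ^ 'n \<Rightarrow> complex) \<Rightarrow> complex ^ 'n \<Rightarrow> complex ^ 'n \<Rightarrow> complex \<Rightarrow> complex" where
  "difference_quotient p x a s =
     (if s = 0 then linear_form (gradient p x) a else (p (x + s *s a) - p x) / s)"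

lemma difference_quotient_mult:
  "s * difference_quotient p x a s = p (x + s *s a) - p x"
  by (simp add: difference_quotient_def)

text \<open>Returning along the same segment cancels the increment; at \<open>s = 0\<close> this is
  linearity of the differential. Lifts of inverse shears are therefore inverse on the divisor as
  well.\<close>

lemma difference_quotient_inverse:
  "difference_quotient p x a s + difference_quotient p (x + s *s a) (- a) s = 0"
proof (cases "s = 0")
  case True
  then show ?thesis by (simp add: difference_quotient_def linear_form_def sum_negf)
next
  case False
  have "x + s *s a + s *s (- a) = x" by (simp add: vec_eq_iff)
  then show ?thesis using False by (simp add: difference_quotient_def flip: add_divide_distrib)
qed

lemma gradient_const: "gradient (\<lambda>z. c) a = 0"
  by (simp add: gradient_def vec_eq_iff)

lemma linear_form_gradient_coord: "linear_form (gradient (\<lambda>z. z $ i) a) w = w $ i"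
  using deriv_line[OF polynomial_fun.coord[of i], of a w]
    DERIV_imp_deriv[OF line_has_field_derivative[of a w i 0]] by simp

lemma linear_form_gradient_add:
  assumes "polynomial_fun f" "polynomial_fun g"
  shows "linear_form (gradient (\<lambda>z. f z + g z) a) w =
    linear_form (gradient f a) w + linear_form (gradient g a) w"
proof (rule DERIV_unique)
  show "((\<lambda>t. f (a + t *s w) + g (a + t *s w)) has_field_derivative
      linear_form (gradient f a) w + linear_form (gradient g a) w) (at 0)"
    by (intro DERIV_add polynomial_fun_line_derivative assms)
qed (rule polynomial_fun_line_derivative[OF polynomial_fun.add[OF assms]])

lemma linear_form_gradient_mult:
  assumes "polynomial_fun f" "polynomial_fun g"
  shows "linear_form (gradient (\<lambda>z. f z * g z) a) w =
    linear_form (gradient f a) w * g a + linear_form (gradient g a) w * f a"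
proof (rule DERIV_unique)
  show "((\<lambda>t. f (a + t *s w) * g (a + t *s w)) has_field_derivative
      linear_form (gradient f a) w * g a + linear_form (gradient g a) w * f a) (at 0)"
    using DERIV_mult[OF polynomial_fun_line_derivative[OF assms(1), of a w]
        polynomial_fun_line_derivative[OF assms(2), of a w]] by simp
qed (rule polynomial_fun_line_derivative[OF polynomial_fun.mult[OF assms]])

text \<open>Induction on \<open>p\<close> removes the division by \<open>s\<close>: the quotient of
  a product is a polynomial expression in the quotients of its factors, their values and
  \<open>s\<close>. This is the reason why lifts are regular.\<close>

lemma polynomial_fun_difference_quotient:
  assumes "polynomial_fun p" "\<And>i. polynomial_fun (\<lambda>z. x z $ i)"
    "\<And>i. polynomial_fun (\<lambda>z. a z $ i)" "polynomial_fun s"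
  shows "polynomial_fun (\<lambda>z. difference_quotient p (x z) (a z) (s z))"
  using assms(1)
proof induction
  case (const c)
  show ?case
    by (simp add: difference_quotient_def gradient_const linear_form_def polynomial_fun.const
        cong: if_cong)
next
  case (coord i)
  have "difference_quotient (\<lambda>z. z $ i) y b r = b $ i" for y b r
    by (simp add: difference_quotient_def linear_form_gradient_coord)
  then show ?case using assms(3) by simp
next
  case (add f g)
  have "difference_quotient (\<lambda>z. f z + g z) y b r =
      difference_quotient f y b r + difference_quotient g y b r" for y b r
    by (simp add: difference_quotient_def linear_form_gradient_add add.hyps
        flip: add_divide_distrib)
  then show ?case using add.IH by (simp add: polynomial_fun.add)
next
  case (mult f g)
  have "difference_quotient (\<lambda>z. f z * g z) y b r =
      difference_quotient f y b r * g y + f y * difference_quotient g y b r +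
      r * (difference_quotient f y b r * difference_quotient g y b r)" for y b r
    by (simp add: difference_quotient_def linear_form_gradient_mult mult.hyps field_simps)
  moreover have "polynomial_fun (\<lambda>z. f (x z))" "polynomial_fun (\<lambda>z. g (x z))"
    by (rule polynomial_fun_compose, rule mult.hyps, rule assms)+
  ultimately show ?case
    using mult.IH assms(4) by (simp add: polynomial_fun.add polynomial_fun.mult)
qed

lemma polynomial_curve_difference_quotient:
  assumes "polynomial_fun p"
  shows "\<exists>P. \<forall>t. difference_quotient p x (t *s w) s = poly P t"
proof -
  \<comment> \<open>The parameter \<open>t\<close> is modelled as the only coordinate of
    \<open>complex^1\<close>.\<close>
  have "polynomial_fun (\<lambda>z::complex^1. difference_quotient p x (z $ 1 *s w) s)"
    by (rule polynomial_fun_difference_quotient[OF assms])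
      (auto intro!: polynomial_fun.intros)
  then have "\<exists>P. \<forall>t. difference_quotient p x ((\<chi> _::1. t) $ 1 *s w) s = poly P t"
    by (rule polynomial_fun_curve) (rule exI[of _ "[:0, 1:]"], simp)
  then show ?thesis by simp
qed

section \<open>Interpolation and generic choices\<close>

lemma lagrange_interpolation:
  fixes s :: "'i \<Rightarrow> 'a::field"
  assumes "finite I" "inj_on s I" "i \<in> I"
  shows "\<exists>P. \<forall>j\<in>I. poly P (s j) = (if j = i then 1 else 0)"
proof (intro exI ballI)
  fix j assume "j \<in> I"
  then show "poly (\<Prod>k\<in>I - {i}. smult (1 / (s i - s k)) [:- s k, 1:]) (s j) = (if j = i then 1 else 0)"
    using assms by (auto simp: poly_prod inj_on_def diff_divide_distrib[symmetric] intro!: prod.neutral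
        split: if_splits)
qed

text \<open>Each polynomial excludes only finitely many parameters. Generic linear forms and generic
  shear parameters are obtained from this.\<close>

lemma exists_common_nonroot:
  fixes P :: "'i \<Rightarrow> complex poly"
  assumes "finite I" "\<And>i. i \<in> I \<Longrightarrow> P i \<noteq> 0"
  shows "\<exists>t. \<forall>i\<in>I. poly (P i) t \<noteq> 0"
proof -
  have "finite (\<Union>i\<in>I. {t. poly (P i) t = 0})"
    using assms by (auto intro: poly_roots_finite)
  then obtain t where "t \<notin> (\<Union>i\<in>I. {t. poly (P i) t = 0})"
    using ex_new_if_finite infinite_UNIV_char_0 by blast
  then show ?thesis by blast
qed

lemma polynomial_fun_linear_form:
  "polynomial_fun (linear_form l)"
  unfolding linear_form_def[abs_def] by (auto intro!: polynomial_fun_sum polynomial_fun.intros)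

lemma exists_nonvanishing_linear_form:
  assumes "finite D" "0 \<notin> D"
  shows "\<exists>l. \<forall>d\<in>D. linear_form l d \<noteq> 0"
  using assms
proof induction
  case (insert e D)
  then obtain l where l: "\<forall>d\<in>D. linear_form l d \<noteq> 0" by auto
  obtain i where i: "e $ i \<noteq> 0" using insert.prems by (auto simp: vec_eq_iff)
  \<comment> \<open>\<open>P d\<close> is the value at \<open>d\<close> of \<open>l\<close>
    perturbed by \<open>t\<close> times the \<open>i\<close>-th coordinate form. Its constant term
    is nonzero for \<open>d\<close> in \<open>D\<close>, its linear coefficient for
    \<open>d = e\<close>.\<close>
  define P where "P d = [:linear_form l d, d $ i:]" for d
  obtain t where t: "\<forall>d\<in>insert e D. poly (P d) t \<noteq> 0"
    using exists_common_nonroot[of "insert e D" P] insert.hyps l i by (auto simp: P_def)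
  have "linear_form (l + t *s axis i 1) d = poly (P d) t" for d
    by (simp add: P_def linear_form_def axis_def distrib_right sum.distrib
        if_distrib[of "\<lambda>x. x * _"] if_distrib[of "\<lambda>x. _ * x"] cong: if_cong)
  then show ?case using t by metis
qed simp

text \<open>Injectivity means nonvanishing on the pairwise differences; the additional vector
  \<open>e\<close> allows a direction outside the kernel to be prescribed at the same time.\<close>

lemma exists_separating_linear_form:
  fixes y :: "'i \<Rightarrow> complex ^ 'n"
  assumes "finite I" "inj_on y I" "e \<noteq> 0"
  shows "\<exists>l. inj_on (\<lambda>i. linear_form l (y i)) I \<and> linear_form l e \<noteq> 0"
proof -
  let ?D = "insert e ((\<lambda>(i, j). y i - y j) ` {(i, j) \<in> I \<times> I. i \<noteq> j})"
  have "finite ?D"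
    by (rule finite.insertI, rule finite_imageI, rule finite_subset[of _ "I \<times> I"])
      (use assms(1) in auto)
  moreover have "0 \<notin> ?D"
  proof
    assume "0 \<in> ?D"
    then obtain i j where "i \<in> I" "j \<in> I" "i \<noteq> j" "y i = y j"
      using assms(3) by (auto simp: eq_commute[of 0])
    then show False using assms(2) by (blast dest: inj_onD)
  qed
  ultimately obtain l where l: "\<forall>d\<in>?D. linear_form l d \<noteq> 0"
    using exists_nonvanishing_linear_form by blast
  have "inj_on (\<lambda>i. linear_form l (y i)) I"
  proof (rule inj_onI, rule ccontr)
    fix i j assume "i \<in> I" "j \<in> I" "i \<noteq> j"
      and eq: "linear_form l (y i) = linear_form l (y j)"
    then have "y i - y j \<in> ?D" by (intro insertI2 image_eqI[of _ _ "(i, j)"]) auto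
    then have "linear_form l (y i - y j) \<noteq> 0" using l by blast
    then show False using eq by (simp add: linear_form_diff)
  qed
  then show ?thesis using l by blast
qed

section \<open>Infinite fibres of a nonconstant polynomial\<close>

text \<open>This second direction is the form in which \<open>k \<ge> 2\<close> enters, both for the
  fibres of \<open>p\<close> and for the shears.\<close>

lemma exists_other_index:
  fixes i :: "'k::finite"
  assumes "CARD('k) \<ge> 2"
  shows "\<exists>j. j \<noteq> i"
  using assms by (metis (full_types) UNIV_I card_2_iff' card_le_Suc0_iff_eq finite
      not_less_eq_eq numeral_2_eq_2)

text \<open>The line through \<open>a\<close> and \<open>b\<close> has infinitely many parallel
  translates on which \<open>p\<close> is nonconstant. By the fundamental theorem of algebra each of
  them meets the fibre, and the points found are distinct.\<close>

lemma infinite_fibre: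
  fixes p :: "complex ^ 'k \<Rightarrow> complex"
  assumes "CARD('k) \<ge> 2" "polynomial_fun p" "p a \<noteq> p b"
  shows "infinite {x. p x = c}"
proof -
  define w where "w = b - a"
  have "w \<noteq> 0" using assms(3) by (auto simp: w_def)
  then obtain i where i: "w $ i \<noteq> 0" by (auto simp: vec_eq_iff)
  obtain j where j: "j \<noteq> i"
    using exists_other_index[OF assms(1)] by blast
  \<comment> \<open>Since \<open>e $ i = 0\<close> and \<open>w $ i \<noteq> 0\<close>, the vectors
    \<open>e\<close> and \<open>w\<close> are independent, so translation by multiples of
    \<open>e\<close> gives distinct lines.\<close>
  define e :: "complex ^ 'k" where "e = axis j 1"
  have e: "e $ i = 0" "e $ j = 1" using j by (auto simp: e_def axis_def)
  obtain A where A: "\<And>r. p (a + r *s e) = poly A r"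
    using polynomial_fun_line[OF assms(2)] by metis
  obtain B where B: "\<And>r. p (b + r *s e) = poly B r"
    using polynomial_fun_line[OF assms(2)] by metis
  have "poly A 0 \<noteq> poly B 0" using A[of 0] B[of 0] assms(3) by simp
  then have "A - B \<noteq> 0" by auto
  \<comment> \<open>On these translates \<open>p\<close> separates the images of \<open>a\<close>
    and \<open>b\<close>; all but finitely many \<open>r\<close> qualify, as \<open>A - B\<close> is
    nonzero at \<open>0\<close>.\<close>
  define R where "R = {r. poly A r \<noteq> poly B r}"
  have "R = - {r. poly (A - B) r = 0}" by (auto simp: R_def)
  then have "infinite R"
    using poly_roots_finite[OF \<open>A - B \<noteq> 0\<close>] infinite_UNIV_char_0[where 'a = complex]
    by (metis finite_compl)
  have "\<exists>s. p (a + r *s e + s *s w) = c" if "r \<in> R" for r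
  proof -
    obtain Q where Q: "\<And>s. p (a + r *s e + s *s w) = poly Q s"
      using polynomial_fun_line[OF assms(2)] by metis
    have "a + r *s e + 1 *s w = b + r *s e" by (simp only: w_def vec_eq_iff) simp
    then have "poly Q 0 \<noteq> poly Q 1" using Q[of 0] Q[of 1] A[of r] B[of r] that
      by (auto simp only: R_def vector_smult_lzero add.right_neutral mem_Collect_eq)
    then have "\<exists>s. poly (Q - [:c:]) s = 0"
      by (intro fundamental_theorem_of_algebra_alt) (auto simp: algebra_simps)
    then show ?thesis using Q by auto
  qed
  then obtain s where s: "\<And>r. r \<in> R \<Longrightarrow> p (a + r *s e + s r *s w) = c" by metis
  have "inj_on (\<lambda>r. a + r *s e + s r *s w) R"
  proof (rule inj_onI)
    fix r t assume "a + r *s e + s r *s w = a + t *s e + s t *s w"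
    then have "(a + r *s e + s r *s w) $ n = (a + t *s e + s t *s w) $ n" for n
      by (rule arg_cong)
    note this[of i] and * = this[of j]
    then have "s r = s t" using e i by simp
    then show "r = t" using e * by simp
  qed
  then have "infinite ((\<lambda>r. a + r *s e + s r *s w) ` R)"
    using \<open>infinite R\<close> by (simp add: finite_image_iff)
  then show ?thesis by (rule infinite_super[rotated]) (use s in auto)
qed

lemma exists_injective_choice:
  fixes F :: "'i \<Rightarrow> 'a set"
  assumes "finite I" "\<And>i. i \<in> I \<Longrightarrow> infinite (F i)"
  shows "\<exists>y. inj_on y I \<and> (\<forall>i\<in>I. y i \<in> F i)"
  using assms
proof induction
  case (insert n I)
  then obtain y where y: "inj_on y I" "\<forall>i\<in>I. y i \<in> F i" by auto
  obtain b where b: "b \<in> F n" "b \<notin> y ` I"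
    using insert by (metis finite_imageI insertI1 rev_finite_subset subsetI)
  show ?case
    by (rule exI[of _ "y(n := b)"]) (use y b insert.hyps in \<open>auto simp: inj_on_def\<close>)
qed simp

section \<open>Tangent spaces and singular points\<close>

lemma zariski_tangent_space_eq:
  "zariski_tangent_space S a =
    {w. \<forall>f. polynomial_fun f \<and> (\<forall>z\<in>S. f z = 0) \<longrightarrow> linear_form (gradient f a) w = 0}"
  unfolding zariski_tangent_space_def by (auto simp: deriv_line)

lemma subspace_zariski_tangent_space: "vec.subspace (zariski_tangent_space S a)"
  by (rule vec.subspaceI)
    (auto simp: zariski_tangent_space_eq linear_form_add linear_form_scale linear_form_zero)

lemma zariski_tangent_spaceD:
  assumes "w \<in> zariski_tangent_space S a" "polynomial_fun f" "\<And>z. z \<in> S \<Longrightarrow> f z = 0"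
    "((\<lambda>t. f (a + t *s w)) has_field_derivative D) (at 0)"
  shows "D = 0"
  using assms DERIV_imp_deriv unfolding zariski_tangent_space_def by fast

text \<open>The differential of \<^term>\<open>F\<close> is injective on the tangent space, being inverted by the
  differential of \<^term>\<open>G\<close>.\<close>

lemma dim_zariski_tangent_space_le:
  fixes F :: "complex ^ 'n \<Rightarrow> complex ^ 'n"
  assumes F: "\<And>j. polynomial_fun (\<lambda>z. F z $ j)" "\<And>z. z \<in> S \<Longrightarrow> F z \<in> S"
    and G: "\<And>j. polynomial_fun (\<lambda>z. G z $ j)" "\<And>z. z \<in> S \<Longrightarrow> G (F z) = z"
  shows "vec.dim (zariski_tangent_space S a) \<le> vec.dim (zariski_tangent_space S (F a))"
proof -
  define J where "J w = (\<chi> j. linear_form (gradient (\<lambda>z. F z $ j) a) w)" for w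
  define K where "K w = (\<chi> j. linear_form (gradient (\<lambda>z. G z $ j) (F a)) w)" for w
  have chain: "((\<lambda>t. f (F (a + t *s w))) has_field_derivative
      linear_form (gradient f (F a)) (J w)) (at 0)" if "polynomial_fun f" for f w
    by (rule polynomial_fun_chain_rule[OF that])
      (use polynomial_fun_line_derivative[OF F(1)] in \<open>simp_all add: J_def\<close>)
  have "w \<in> K ` zariski_tangent_space S (F a)" if w: "w \<in> zariski_tangent_space S a" for w
  proof (rule image_eqI)
    show "w = K (J w)"
    proof (rule vec_eq_iff[THEN iffD2, rule_format])
      fix j
      have "((\<lambda>t. G (F (a + t *s w)) $ j - (a + t *s w) $ j) has_field_derivative
          K (J w) $ j - w $ j) (at 0)"
        unfolding K_def vec_lambda_beta
        by (intro DERIV_diff chain G(1) line_has_field_derivative)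
      \<comment> \<open>This polynomial vanishes on \<open>S\<close>, where \<open>G\<close> inverts
        \<open>F\<close>, so its differential kills \<open>w\<close>.\<close>
      moreover have "polynomial_fun (\<lambda>z. G (F z) $ j - z $ j)"
        by (intro polynomial_fun_diff polynomial_fun.coord polynomial_fun_compose[OF G(1) F(1)])
      ultimately have "K (J w) $ j - w $ j = 0"
        by (intro zariski_tangent_spaceD[OF w, of "\<lambda>z. G (F z) $ j - z $ j" "K (J w) $ j - w $ j"])
          (simp_all add: G(2))
      then show "w $ j = K (J w) $ j" by simp
    qed
    show "J w \<in> zariski_tangent_space S (F a)"
      unfolding zariski_tangent_space_eq
    proof (intro CollectI allI impI)
      fix f assume f: "polynomial_fun f \<and> (\<forall>z\<in>S. f z = 0)"
      show "linear_form (gradient f (F a)) (J w) = 0"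
        by (rule zariski_tangent_spaceD[OF w polynomial_fun_compose[OF _ F(1)] _ chain])
          (use f F(2) in auto)
    qed
  qed
  then have "zariski_tangent_space S a \<subseteq> K ` zariski_tangent_space S (F a)" by blast
  then have "vec.dim (zariski_tangent_space S a) \<le> vec.dim (K ` zariski_tangent_space S (F a))"
    by (rule vec.dim_subset)
  also have "\<dots> \<le> vec.dim (zariski_tangent_space S (F a))"
    by (rule vec.dim_image_le, unfold_locales)
      (simp_all add: K_def vec_eq_iff linear_form_add linear_form_scale)
  finally show ?thesis .
qed

text \<open>Polynomial extensions of \<open>h\<close> and of its inverse are inverse to each other
  on \<open>S\<close>, so the inequality of dimensions holds in both directions.\<close>

lemma dim_zariski_tangent_space_Aut:
  assumes "h \<in> Aut S" "a \<in> S"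
  shows "vec.dim (zariski_tangent_space S (h a)) = vec.dim (zariski_tangent_space S a)"
proof -
  have h: "bij_betw h S S" and "regular_map_on S h" "regular_map_on S (inv_into S h)"
    using assms(1) by (auto simp: Aut_def Bij_def)
  then obtain F G where F: "\<And>j. polynomial_fun (\<lambda>z. F z $ j)" "\<And>z. z \<in> S \<Longrightarrow> h z = F z"
    and G: "\<And>j. polynomial_fun (\<lambda>z. G z $ j)" "\<And>z. z \<in> S \<Longrightarrow> inv_into S h z = G z"
    unfolding regular_map_on_def by metis
  have S: "F z \<in> S" "G z \<in> S" if "z \<in> S" for z
    using that F(2) G(2) bij_betw_apply[OF h] bij_betw_apply[OF bij_betw_inv_into[OF h]] by auto
  have inv: "G (F z) = z" "F (G z) = z" if "z \<in> S" for z
    using that F(2) G(2) S bij_betw_inv_into_left[OF h] bij_betw_inv_into_right[OF h] by metis+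
  have "vec.dim (zariski_tangent_space S a) \<le> vec.dim (zariski_tangent_space S (F a))"
    using F(1) S(1) G(1) inv(1) by (rule dim_zariski_tangent_space_le)
  moreover have "vec.dim (zariski_tangent_space S (F a)) \<le>
      vec.dim (zariski_tangent_space S (G (F a)))"
    using G(1) S(2) F(1) inv(2) by (rule dim_zariski_tangent_space_le)
  ultimately show ?thesis using F(2) inv(1) assms(2) by simp
qed

text \<open>As \<open>sing\<close> compares dimensions of tangent spaces, it suffices to follow
  these dimensions through products and inverses; membership in \<open>Bij S\<close> keeps the
  points inside \<open>S\<close>.\<close>

lemma generate_Aut_preserves:
  assumes "g \<in> generate (BijGroup S) H" "H \<subseteq> Aut S"
  shows "g \<in> Bij S \<and>
    (\<forall>a\<in>S. vec.dim (zariski_tangent_space S (g a)) = vec.dim (zariski_tangent_space S a))"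
  using assms(1)
proof induction
  case one
  show ?case using id_Bij[of S] by (simp add: BijGroup_def restrict_def)
next
  case (incl h)
  then show ?case using assms(2) dim_zariski_tangent_space_Aut by (auto simp: Aut_def)
next
  case (inv h)
  then have h: "h \<in> Aut S" "h \<in> Bij S" using assms(2) by (auto simp: Aut_def)
  have "vec.dim (zariski_tangent_space S (inv_into S h a)) = vec.dim (zariski_tangent_space S a)"
    if "a \<in> S" for a
    using dim_zariski_tangent_space_Aut[OF h(1), of "inv_into S h a"] that h(2)
    by (metis Bij_imp_funcset Bij_inv_into_lemma Bij_def Int_iff bij_betw_inv_into_right
        bij_betw_imp_surj_on inv_into_into mem_Collect_eq)
  then show ?case using h(2) restrict_inv_into_Bij[OF h(2)]
    by (simp add: inv_BijGroup restrict_def)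
next
  case (eng g h)
  then have "g \<in> Bij S" "h \<in> Bij S" by auto
  moreover have "h a \<in> S" if "a \<in> S" for a
    using that eng Bij_imp_funcset by blast
  ultimately show ?case using eng by (simp add: BijGroup_def compose_Bij compose_eq)
qed

lemma generate_Aut_bij_betw_nonsing:
  assumes "g \<in> generate (BijGroup S) H" "H \<subseteq> Aut S"
  shows "bij_betw g (S - sing S) (S - sing S)"
proof -
  have g: "bij_betw g S S"
    and dim: "\<And>a. a \<in> S \<Longrightarrow> vec.dim (zariski_tangent_space S (g a)) = vec.dim (zariski_tangent_space S a)"
    using generate_Aut_preserves[OF assms] by (auto simp: Bij_def)
  have *: "g a \<in> sing S \<longleftrightarrow> a \<in> sing S" if "a \<in> S" for a
    using that dim[OF that] bij_betw_apply[OF g] by (auto simp: sing_def)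
  have "bij_betw g (S - sing S) (g ` (S - sing S))"
    by (rule bij_betw_subset[OF g]) auto
  moreover have "g ` (S - sing S) = S - sing S"
  proof (intro equalityI subsetI)
    fix y assume y: "y \<in> S - sing S"
    then obtain a where "a \<in> S" "y = g a" using bij_betw_imp_surj_on[OF g] by auto
    then show "y \<in> g ` (S - sing S)" using y * by auto
  qed (use * bij_betw_apply[OF g] in auto)
  ultimately show ?thesis by simp
qed

section \<open>Symmetric coordinates on the hypersurface and its critical points\<close>

lemma two_cases:
  assumes "c \<noteq> d"
  shows "e = c \<or> e = (d :: 2)"
proof (rule ccontr)
  assume "\<not> (e = c \<or> e = d)"
  then have "card {c, d, e} = 3" using assms by auto
  moreover have "card {c, d, e} \<le> CARD(2)" by (rule card_mono) auto
  ultimately show False by simp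
qed

lemma UNIV_two: "c \<noteq> d \<Longrightarrow> (UNIV :: 2 set) = {c, d}"
  using two_cases by blast

text \<open>Naming the slot of \<open>r\<close> by an index turns the symmetry between
  \<open>u\<close> and \<open>v\<close> into an interchange of indices, so that each argument is
  made only once.\<close>

definition hpoint :: "2 \<Rightarrow> complex ^ 'k \<Rightarrow> complex \<Rightarrow> complex \<Rightarrow> complex ^ ('k + 2)" where
  "hpoint c x r s = (\<chi> j. case j of Inl i \<Rightarrow> x $ i | Inr e \<Rightarrow> if e = c then r else s)"

lemma hpoint_simps [simp]:
  "base (hpoint c x r s) = x"
  "hpoint c x r s $ Inl i = x $ i"
  "hpoint c x r s $ Inr c = r"
  "d \<noteq> c \<Longrightarrow> hpoint c x r s $ Inr d = s"
  by (simp_all add: hpoint_def base_def)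

lemma hpoint_eqI:
  fixes z z' :: "complex ^ ('k::finite + 2)"
  assumes "base z = base z'" "c \<noteq> d" "z $ Inr c = z' $ Inr c" "z $ Inr d = z' $ Inr d"
  shows "z = z'"
proof (rule vec_eq_iff[THEN iffD2, rule_format])
  fix j
  show "z $ j = z' $ j"
  proof (cases j)
    case (Inl i)
    then show ?thesis using arg_cong[OF assms(1), of "\<lambda>x. x $ i"] by (simp add: base_def)
  next
    case (Inr e)
    then show ?thesis using assms two_cases[OF assms(2), of e] by auto
  qed
qed

lemma mem_hypersurface_iff:
  assumes "c \<noteq> d"
  shows "z \<in> hypersurface p \<longleftrightarrow> z $ Inr c * z $ Inr d = p (base z)"
  using two_cases[of 0 1 c] two_cases[of 0 1 d] assms
  by (auto simp: hypersurface_def mult.commute)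

lemma linear_form_hpoint:
  assumes "c \<noteq> d"
  shows "linear_form g (hpoint c w r s) =
    linear_form (base g) w + g $ Inr c * r + g $ Inr d * s"
proof -
  have "linear_form g (hpoint c w r s) =
      (\<Sum>i\<in>UNIV. g $ Inl i * w $ i) + (\<Sum>e\<in>UNIV. g $ Inr e * hpoint c w r s $ Inr e)"
    by (simp add: linear_form_def sum.Plus flip: UNIV_Plus_UNIV)
  then show ?thesis using assms by (simp add: UNIV_two[OF assms] linear_form_def base_def)
qed

lemma polynomial_fun_base: "polynomial_fun (\<lambda>z. base z $ i)"
  by (simp add: base_def polynomial_fun.coord)

lemma polynomial_fun_compose_base:
  "polynomial_fun p \<Longrightarrow> polynomial_fun (\<lambda>z. p (base z))"
  by (rule polynomial_fun_compose[OF _ polynomial_fun_base])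

text \<open>If \<open>p\<close> vanishes to second order at \<open>x\<close>, then \<open>p (x + t w) = t q(t)\<close> with \<open>q(0) = 0\<close>, and for
  \<open>r \<noteq> 0\<close> the curve \<open>(x + t w, r t, q(t) / r)\<close> on the hypersurface has tangent vector
  \<open>(w, r, q'(0) / r)\<close> at \<open>t = 0\<close>.\<close>

lemma gradient_vanishes_on_critical:
  fixes p :: "complex ^ 'k \<Rightarrow> complex"
  assumes p: "polynomial_fun p" "gradient p (base z) = 0" "p (base z) = 0"
    and cd: "c \<noteq> d" "z $ Inr c = 0" "z $ Inr d = 0"
    and f: "polynomial_fun f" "\<And>y. y \<in> hypersurface p \<Longrightarrow> f y = 0"
  shows "linear_form (base (gradient f z)) w = 0 \<and> gradient f z $ Inr c = 0"
proof -
  define g where "g = gradient f z"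
  obtain P where P: "\<And>t. p (base z + t *s w) = poly P t"
    using polynomial_fun_line[OF p(1)] by metis
  have "poly P 0 = 0" using P[of 0] p(3) by simp
  then obtain Q where Q: "P = pCons 0 Q" by (cases P) auto
  have "((\<lambda>t. poly P t) has_field_derivative 0) (at 0)"
    using polynomial_fun_line_derivative[OF p(1), of "base z" w] p(2)
    by (simp add: P linear_form_def)
  then have "poly (pderiv P) 0 = 0" using poly_DERIV DERIV_unique by blast
  then have Q0: "poly Q 0 = 0" by (simp add: Q pderiv_pCons)
  define q where "q = poly (pderiv Q) 0"
  have curve: "linear_form (base g) w + g $ Inr c * r + g $ Inr d * (q / r) = 0" if "r \<noteq> 0" for r
  proof -
    define \<gamma> where "\<gamma> t = hpoint c (base z + t *s w) (r * t) (poly Q t / r)" for t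
    have "\<gamma> t \<in> hypersurface p" for t
      using that cd by (simp add: mem_hypersurface_iff[OF cd(1)] \<gamma>_def P Q)
    then have "((\<lambda>t. f (\<gamma> t)) has_field_derivative 0) (at 0)" using f(2) by simp
    moreover have "\<gamma> 0 = z"
      by (rule hpoint_eqI[OF _ cd(1)]) (use cd Q0 in \<open>auto simp: \<gamma>_def\<close>)
    moreover have "((\<lambda>t. \<gamma> t $ j) has_field_derivative hpoint c w r (q / r) $ j) (at 0)" for j
    proof (cases j)
      case (Inl i)
      then show ?thesis using line_has_field_derivative[of "base z" w i 0] by (simp add: \<gamma>_def)
    next
      case (Inr e)
      then show ?thesis
        using cd DERIV_cdivide[OF poly_DERIV[of Q 0], of r] that two_cases[OF cd(1), of e]
        by (auto simp: \<gamma>_def q_def intro!: derivative_eq_intros)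
    qed
    ultimately have "linear_form g (hpoint c w r (q / r)) = 0"
      unfolding g_def using polynomial_fun_chain_rule[OF f(1)] DERIV_unique by blast
    then show ?thesis by (simp add: linear_form_hpoint[OF cd(1)])
  qed
  \<comment> \<open>These are relations \<open>A + B * r + C / r = 0\<close> with coefficients
    independent of \<open>r\<close>: the values \<open>1\<close> and \<open>-1\<close> give
    \<open>A = 0\<close> and \<open>B + C = 0\<close>, and \<open>2\<close> then gives
    \<open>B = 0\<close>.\<close>
  from curve[of 1] curve[of "-1"] curve[of 2]
  have "linear_form (base g) w = 0" "g $ Inr c = 0" by (simp_all, algebra+)
  then show ?thesis by (simp add: g_def)
qed

text \<open>All differentials of functions vanishing on the hypersurface are zero at
  \<open>z\<close>, so the tangent space there is everything, while at another point over the same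
  base point the defining equation cuts it down.\<close>

lemma critical_point_in_sing:
  fixes p :: "complex ^ 'k \<Rightarrow> complex"
  assumes p: "polynomial_fun p" "gradient p (base z) = 0"
    and z: "z \<in> hypersurface p" and cd: "c \<noteq> d" "z $ Inr c = 0" "z $ Inr d = 0"
  shows "z \<in> sing (hypersurface p)"
proof -
  let ?X = "hypersurface p"
  have p0: "p (base z) = 0" using z cd by (simp add: mem_hypersurface_iff[OF cd(1)])
  have "linear_form (gradient f z) w = 0"
    if f: "polynomial_fun f" "\<And>y. y \<in> ?X \<Longrightarrow> f y = 0" for f w
  proof -
    have w: "w = hpoint c (base w) (w $ Inr c) (w $ Inr d)"
      by (rule hpoint_eqI[OF _ cd(1)]) (use cd in auto)
    show ?thesis
      \<comment> \<open>Both orders of \<open>c\<close> and \<open>d\<close> are used, since each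
        controls only the first of the two coordinates.\<close>
      using gradient_vanishes_on_critical[OF p p0 cd f]
        gradient_vanishes_on_critical[OF p p0 cd(1)[symmetric] cd(3,2) f]
      by (subst w) (simp add: linear_form_hpoint[OF cd(1)])
  qed
  then have z_full: "zariski_tangent_space ?X z = UNIV"
    by (auto simp: zariski_tangent_space_eq)
  \<comment> \<open>At this comparison point the defining equation has partial derivative
    \<open>1\<close> in the direction \<open>d\<close>, which is therefore not tangent.\<close>
  define b where "b = hpoint c (base z) 1 0"
  have b: "b \<in> ?X" using cd p0 by (simp add: mem_hypersurface_iff[OF cd(1)] b_def)
  have "axis (Inr d) 1 \<notin> zariski_tangent_space ?X b"
  proof
    assume *: "axis (Inr d) 1 \<in> zariski_tangent_space ?X b"
    have "polynomial_fun (\<lambda>y. y $ Inr c * y $ Inr d - p (base y))"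
      by (intro polynomial_fun_diff polynomial_fun.intros polynomial_fun_compose_base p)
    moreover have "(b + t *s axis (Inr d) 1) $ Inr c * (b + t *s axis (Inr d) 1) $ Inr d -
        p (base (b + t *s axis (Inr d) 1)) = t" for t
    proof -
      have "base (b + t *s axis (Inr d) 1) = base z"
        by (simp add: b_def base_def vec_eq_iff axis_def)
      then show ?thesis using cd p0 by (simp add: b_def axis_def)
    qed
    ultimately have "(1::complex) = 0"
      using zariski_tangent_spaceD[OF *, of "\<lambda>y. y $ Inr c * y $ Inr d - p (base y)" 1]
        mem_hypersurface_iff[OF cd(1), of _ p] by simp
    then show False by simp
  qed
  then have "zariski_tangent_space ?X b \<noteq> UNIV" by blast
  then have "vec.dim (zariski_tangent_space ?X b) < vec.dim (zariski_tangent_space ?X z)"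
    by (intro vec.dim_psubset)
      (simp add: z_full vec.span_eq_iff[THEN iffD2, OF subspace_zariski_tangent_space] psubset_eq)
  then show ?thesis using z b by (auto simp: sing_def)
qed

section \<open>Shears and their lifts\<close>

lemma append_coord_simps [simp]:
  "base (append_coord x t) = x"
  "append_coord x t $ Inl i = x $ i"
  "append_coord x t $ Inr e = t"
  by (simp_all add: append_coord_def base_def)

lemma base_simps [simp]:
  "base (x + y) = base x + base y" "base (c *s x) = c *s base x" "base (x - y) = base x - base y"
  "base 0 = 0" "base (- x) = - base x"
  by (simp_all add: base_def vec_eq_iff)

lemma append_coord_eqI:
  fixes y z :: "complex ^ ('k::finite + 1)"
  assumes "base y = base z" "y $ Inr 1 = z $ Inr 1"
  shows "y = z"
proof (rule vec_eq_iff[THEN iffD2, rule_format])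
  fix j
  show "y $ j = z $ j"
  proof (cases j)
    case (Inl i)
    then show ?thesis using arg_cong[OF assms(1), of "\<lambda>x. x $ i"] by (simp add: base_def)
  next
    case (Inr e)
    moreover have "e = 1" by (rule num1_eqI)
    ultimately show ?thesis using assms(2) by simp
  qed
qed

text \<open>\<open>proj 1\<close> is \<open>\<sigma>\<^sub>1\<close> and \<open>proj 0\<close> is
  \<open>\<sigma>\<^sub>2\<close>.\<close>

definition proj :: "2 \<Rightarrow> complex ^ ('k::finite + 2) \<Rightarrow> complex ^ ('k + 1)" where
  "proj c z = append_coord (base z) (z $ Inr c)"

lemma proj_simps [simp]: "base (proj c z) = base z" "proj c z $ Inr e = z $ Inr c"
  by (simp_all add: proj_def)

text \<open>Where the coordinate \<open>c\<close> is nonzero, the equation of the hypersurface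
  determines the coordinate \<open>d\<close>.\<close>

lemma proj_inject:
  assumes "c \<noteq> d" "z \<in> hypersurface p" "z' \<in> hypersurface p" "z $ Inr c \<noteq> 0"
    "proj c z = proj c z'"
  shows "z = z'"
proof (rule hpoint_eqI[OF _ assms(1)])
  show base: "base z = base z'" and c: "z $ Inr c = z' $ Inr c"
    using arg_cong[OF assms(5), of base] arg_cong[OF assms(5), of "\<lambda>y. y $ Inr 1"] by simp_all
  have "z $ Inr c * z $ Inr d = z $ Inr c * z' $ Inr d"
    using assms(2,3) base c by (simp add: mem_hypersurface_iff[OF assms(1)])
  then show "z $ Inr d = z' $ Inr d" using assms(4) by simp
qed

text \<open>The first two conditions make the last coordinate and \<open>l\<close> invariants of the
  shear, so that the displacement per unit time is constant along each orbit.\<close>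

definition shear_data ::
    "complex ^ ('k::finite + 1) \<Rightarrow> (complex \<Rightarrow> complex ^ ('k + 1)) \<Rightarrow> bool" where
  "shear_data l \<Phi> \<longleftrightarrow> (\<forall>s. \<Phi> s $ Inr 1 = 0) \<and> (\<forall>s. linear_form l (\<Phi> s) = 0) \<and>
     (\<forall>j. \<exists>P. \<forall>s. \<Phi> s $ j = poly P s)"

text \<open>The time-\<open>t\<close> flow of a locally nilpotent vector field. The factor
  \<open>z $ Inr 1\<close> makes it the identity on the hyperplane, so that \<open>X_0\<close> is
  preserved whatever \<open>p\<close> is, and makes the displacement divisible by that coordinate,
  as the lift requires.\<close>

definition shear ::
    "complex ^ ('k::finite + 1) \<Rightarrow> (complex \<Rightarrow> complex ^ ('k + 1)) \<Rightarrow> complex \<Rightarrow>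
     complex ^ ('k + 1) \<Rightarrow> complex ^ ('k + 1)" where
  "shear l \<Phi> t z = z + (t * z $ Inr 1) *s \<Phi> (linear_form l z)"

lemma shear_zero [simp]: "shear l \<Phi> 0 z = z"
  by (simp add: shear_def)

lemma shear_coord:
  assumes "shear_data l \<Phi>"
  shows "shear l \<Phi> t z $ Inr 1 = z $ Inr 1"
  using assms by (simp add: shear_def shear_data_def)

lemma linear_form_shear:
  assumes "shear_data l \<Phi>"
  shows "linear_form l (shear l \<Phi> t z) = linear_form l z"
  using assms by (simp add: shear_def shear_data_def linear_form_add linear_form_scale)

lemma shear_shear:
  assumes "shear_data l \<Phi>"
  shows "shear l \<Phi> s (shear l \<Phi> t z) = shear l \<Phi> (s + t) z"
proof -
  have "shear l \<Phi> s (shear l \<Phi> t z) =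
      shear l \<Phi> t z + (s * z $ Inr 1) *s \<Phi> (linear_form l z)"
    by (subst (1) shear_def) (simp only: shear_coord[OF assms] linear_form_shear[OF assms])
  then show ?thesis by (simp add: shear_def vec_eq_iff algebra_simps)
qed

lemma polynomial_fun_shear_data:
  assumes "shear_data l \<Phi>" "polynomial_fun f"
  shows "polynomial_fun (\<lambda>z. \<Phi> (f z) $ j)"
proof -
  obtain P where "\<And>s. \<Phi> s $ j = poly P s" using assms(1) unfolding shear_data_def by metis
  then show ?thesis by (simp add: polynomial_fun_poly assms(2))
qed

lemma group_C_plus: "group C_plus"
proof (rule groupI)
  fix x assume "x \<in> carrier C_plus"
  show "\<exists>y\<in>carrier C_plus. y \<otimes>\<^bsub>C_plus\<^esub> x = \<one>\<^bsub>C_plus\<^esub>"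
    by (rule bexI[of _ "- x"]) (simp_all add: C_plus_def)
qed (simp_all add: C_plus_def)

lemma shear_in_Bij:
  assumes "shear_data l \<Phi>"
  shows "shear l \<Phi> t \<in> Bij UNIV"
  using assms unfolding Bij_def
  by (auto intro!: bij_betw_byWitness[of _ "shear l \<Phi> (- t)"] simp: shear_shear)

lemma shear_in_G_group:
  fixes l :: "complex ^ ('k::finite + 1)"
  assumes "shear_data l \<Phi>"
  shows "shear l \<Phi> t \<in> G_group p"
proof -
  have "group_hom C_plus (BijGroup UNIV) (shear l \<Phi>)"
  proof (intro group_hom.intro group_hom_axioms.intro group_C_plus group_BijGroup homI)
    fix s t
    show "shear l \<Phi> s \<in> carrier (BijGroup UNIV)"
      using shear_in_Bij[OF assms] by (simp add: BijGroup_def)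
    show "shear l \<Phi> (s \<otimes>\<^bsub>C_plus\<^esub> t) = shear l \<Phi> s \<otimes>\<^bsub>BijGroup UNIV\<^esub> shear l \<Phi> t"
      using shear_in_Bij[OF assms]
      by (simp add: BijGroup_def C_plus_def fun_eq_iff compose_eq shear_shear[OF assms])
  qed
  then have action: "group_action C_plus UNIV (shear l \<Phi>)" by (rule group_action.intro)
  have "polynomial_fun (\<lambda>z :: complex ^ (('k + 1) + 1). shear l \<Phi> (z $ Inr 1) (base z) $ j)" for j
  proof -
    have "polynomial_fun (\<lambda>z :: complex ^ (('k + 1) + 1). base z $ j + z $ Inr 1 * base z $ Inr 1 *
        \<Phi> (linear_form l (base z)) $ j)"
      by (intro polynomial_fun.add polynomial_fun.mult polynomial_fun.coord polynomial_fun_base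
          polynomial_fun_shear_data[OF assms] polynomial_fun_compose_base polynomial_fun_linear_form)
    then show ?thesis by (simp add: shear_def)
  qed
  then have "regular_map_on {z :: complex ^ (('k + 1) + 1). base z \<in> UNIV}
      (\<lambda>z. shear l \<Phi> (z $ Inr 1) (base z))"
    unfolding regular_map_on_def
    by (intro exI[of _ "\<lambda>z. shear l \<Phi> (z $ Inr 1) (base z)"]) simp
  then have "C_plus_subgroup UNIV (range (shear l \<Phi>))"
    using action unfolding C_plus_subgroup_def by blast
  moreover have "shear l \<Phi> s ` {z. z $ Inr 1 = 0 \<and> p (base z) = 0} =
      {z. z $ Inr 1 = 0 \<and> p (base z) = 0}" for s
    by (auto simp: shear_def image_iff)
  ultimately show ?thesis
    unfolding G_group_def
    by (intro generate.incl UnionI[of "range (shear l \<Phi>)"]) (simp_all add: shear_coord[OF assms])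
qed

text \<open>The shear fixes the coordinate \<open>c\<close> and \<open>d\<close> is the other one: \<open>(c, d) = (1, 0)\<close> gives lifts along
  \<open>\<sigma>\<^sub>1\<close>, and \<open>(c, d) = (0, 1)\<close> lifts along \<open>\<sigma>\<^sub>2\<close>.\<close>

definition lift ::
    "2 \<Rightarrow> 2 \<Rightarrow> (complex ^ 'k \<Rightarrow> complex) \<Rightarrow> complex ^ ('k + 1) \<Rightarrow>
     (complex \<Rightarrow> complex ^ ('k + 1)) \<Rightarrow> complex ^ ('k + 2) \<Rightarrow> complex ^ ('k + 2)" where
  "lift c d p l \<Phi> z =
     (let w = base (\<Phi> (linear_form l (proj c z)))
      in hpoint c (base z + z $ Inr c *s w) (z $ Inr c)
           (z $ Inr d + difference_quotient p (base z) w (z $ Inr c)))"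

lemma lift_simps:
  "base (lift c d p l \<Phi> z) = base z + z $ Inr c *s base (\<Phi> (linear_form l (proj c z)))"
  "lift c d p l \<Phi> z $ Inr c = z $ Inr c"
  "c \<noteq> d \<Longrightarrow> lift c d p l \<Phi> z $ Inr d =
     z $ Inr d + difference_quotient p (base z) (base (\<Phi> (linear_form l (proj c z)))) (z $ Inr c)"
  by (simp_all add: lift_def Let_def)

lemma proj_lift:
  assumes "shear_data l \<Phi>"
  shows "proj c (lift c d p l \<Phi> z) = shear l \<Phi> 1 (proj c z)"
proof (rule append_coord_eqI)
  show "base (proj c (lift c d p l \<Phi> z)) = base (shear l \<Phi> 1 (proj c z))"
    by (simp add: lift_simps shear_def)
qed (simp add: shear_coord[OF assms] lift_simps)

text \<open>The increment of the coordinate \<open>d\<close>, multiplied by the coordinate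
  \<open>c\<close>, is exactly the increment of \<open>p\<close>.\<close>

lemma lift_in_hypersurface:
  assumes "c \<noteq> d" "z \<in> hypersurface p"
  shows "lift c d p l \<Phi> z \<in> hypersurface p"
  using assms
  by (simp add: mem_hypersurface_iff[OF assms(1)] lift_simps distrib_left difference_quotient_mult)

lemma shear_data_uminus:
  assumes "shear_data l \<Phi>"
  shows "shear_data l (\<lambda>s. - \<Phi> s)"
proof -
  have "\<exists>P. \<forall>s. - \<Phi> s $ j = poly P s" for j
    using assms unfolding shear_data_def by (metis poly_minus)
  then show ?thesis using assms by (simp add: shear_data_def linear_form_def sum_negf)
qed

text \<open>Negating \<open>\<Phi>\<close> reverses the shear, because \<open>l\<close> has the same
  value at both projected points; the coordinate \<open>d\<close> returns by
  \<open>difference_quotient_inverse\<close>.\<close>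

lemma lift_inverse:
  assumes "shear_data l \<Phi>" "c \<noteq> d"
  shows "lift c d p l (\<lambda>s. - \<Phi> s) (lift c d p l \<Phi> z) = z"
proof (rule hpoint_eqI[OF _ assms(2)])
  have l: "linear_form l (proj c (lift c d p l \<Phi> z)) = linear_form l (proj c z)"
    by (simp add: proj_lift[OF assms(1)] linear_form_shear[OF assms(1)])
  show "base (lift c d p l (\<lambda>s. - \<Phi> s) (lift c d p l \<Phi> z)) = base z"
    by (simp add: lift_simps l vec_eq_iff)
  show "lift c d p l (\<lambda>s. - \<Phi> s) (lift c d p l \<Phi> z) $ Inr c = z $ Inr c"
    by (simp add: lift_simps)
  show "lift c d p l (\<lambda>s. - \<Phi> s) (lift c d p l \<Phi> z) $ Inr d = z $ Inr d"
    using assms(2) difference_quotient_inverse by (simp add: lift_simps l add.assoc)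
qed

lemma polynomial_fun_proj: "polynomial_fun (\<lambda>z. proj c z $ j)"
  by (cases j) (simp_all add: proj_def base_def polynomial_fun.coord)

lemma polynomial_fun_lift:
  assumes p: "polynomial_fun p" and \<Phi>: "shear_data l \<Phi>" and "c \<noteq> d"
  shows "polynomial_fun (\<lambda>z. lift c d p l \<Phi> z $ j)"
proof -
  have w: "polynomial_fun (\<lambda>z. base (\<Phi> (linear_form l (proj c z))) $ i)" for i
    unfolding base_def vec_lambda_beta
    by (rule polynomial_fun_shear_data[OF \<Phi>],
        rule polynomial_fun_compose[OF polynomial_fun_linear_form polynomial_fun_proj])
  show ?thesis
  proof (cases j)
    case (Inl i)
    have "polynomial_fun (\<lambda>z. base z $ i + z $ Inr c * base (\<Phi> (linear_form l (proj c z))) $ i)"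
      by (intro polynomial_fun.add polynomial_fun.mult polynomial_fun_base polynomial_fun.coord w)
    then show ?thesis by (simp add: Inl lift_def Let_def)
  next
    case (Inr e)
    have "polynomial_fun (\<lambda>z. z $ Inr d +
        difference_quotient p (base z) (base (\<Phi> (linear_form l (proj c z)))) (z $ Inr c))"
      by (intro polynomial_fun.add polynomial_fun.coord
          polynomial_fun_difference_quotient[OF p] polynomial_fun_base w)
    then show ?thesis
      using two_cases[OF assms(3), of e] assms(3)
      by (auto simp: Inr lift_simps polynomial_fun.coord)
  qed
qed

text \<open>Stated for any set stable under all lifts, so that it serves both the hypersurface and
  the divisor where the coordinate \<open>c\<close> vanishes.\<close>

lemma lift_bij_betw:
  assumes "shear_data l \<Phi>" "c \<noteq> d"
    and "\<And>\<Psi> z. z \<in> A \<Longrightarrow> lift c d p l \<Psi> z \<in> A"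
  shows "bij_betw (lift c d p l \<Phi>) A A"
proof (rule bij_betw_byWitness[of _ "lift c d p l (\<lambda>s. - \<Phi> s)"])
  show "\<forall>z\<in>A. lift c d p l (\<lambda>s. - \<Phi> s) (lift c d p l \<Phi> z) = z"
    using lift_inverse[OF assms(1,2)] by blast
  show "\<forall>z\<in>A. lift c d p l \<Phi> (lift c d p l (\<lambda>s. - \<Phi> s) z) = z"
    using lift_inverse[OF shear_data_uminus[OF assms(1)] assms(2)] by simp
qed (use assms(3) in auto)

lemma lift_in_Aut:
  assumes p: "polynomial_fun p" and \<Phi>: "shear_data l \<Phi>" and "c \<noteq> d"
  shows "restrict (lift c d p l \<Phi>) (hypersurface p) \<in> Aut (hypersurface p)"
proof -
  let ?X = "hypersurface p" and ?h = "restrict (lift c d p l \<Phi>) (hypersurface p)"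
  have bij: "bij_betw (lift c d p l \<Phi>) ?X ?X"
    by (rule lift_bij_betw[OF \<Phi> assms(3)], rule lift_in_hypersurface[OF assms(3)])
  then have bij': "bij_betw ?h ?X ?X" by (simp cong: bij_betw_cong)
  have "inv_into ?X ?h z = lift c d p l (\<lambda>s. - \<Phi> s) z" if z: "z \<in> ?X" for z
  proof (rule inv_into_f_eq)
    show "inj_on ?h ?X" using bij' by (rule bij_betw_imp_inj_on)
    show "lift c d p l (\<lambda>s. - \<Phi> s) z \<in> ?X" by (rule lift_in_hypersurface[OF assms(3) z])
    then show "?h (lift c d p l (\<lambda>s. - \<Phi> s) z) = z"
      using lift_inverse[OF shear_data_uminus[OF \<Phi>] assms(3)] by simp
  qed
  then have "regular_map_on ?X (inv_into ?X ?h)"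
    unfolding regular_map_on_def using polynomial_fun_lift[OF p shear_data_uminus[OF \<Phi>] assms(3)]
    by blast
  moreover have "regular_map_on ?X ?h"
    unfolding regular_map_on_def using polynomial_fun_lift[OF p \<Phi> assms(3)] by auto
  ultimately show ?thesis using bij' by (simp add: Aut_def Bij_def)
qed

lemma is_lift_lift:
  assumes p: "polynomial_fun p" and \<Phi>: "shear_data l \<Phi>" and "c \<noteq> d"
  shows "is_lift (hypersurface p) (hypersurface p \<inter> {z. z $ Inr c = 0}) (proj c) (shear l \<Phi> 1)
    (restrict (lift c d p l \<Phi>) (hypersurface p))"
  unfolding is_lift_def
proof (intro conjI ballI)
  let ?X = "hypersurface p" and ?E = "hypersurface p \<inter> {z. z $ Inr c = 0}"
  show "restrict (lift c d p l \<Phi>) ?X \<in> Aut ?X" by (rule lift_in_Aut[OF assms])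
  have "bij_betw (lift c d p l \<Phi>) ?E ?E"
    by (rule lift_bij_betw[OF \<Phi> assms(3)]) (auto simp: lift_in_hypersurface[OF assms(3)] lift_simps)
  then show "restrict (lift c d p l \<Phi>) ?X ` ?E = ?E"
    by (simp add: bij_betw_def cong: image_cong_simp)
  fix z assume z: "z \<in> ?X - ?E"
  \<comment> \<open>Injectivity off the divisor makes \<open>inv_into\<close> a true inverse of
    \<open>proj c\<close>, which sends the sheared projection to the lifted point.\<close>
  have "inj_on (proj c) (?X - ?E)"
    using proj_inject[OF assms(3)] by (auto simp: inj_on_def)
  moreover have "lift c d p l \<Phi> z \<in> ?X - ?E"
    using z lift_in_hypersurface[OF assms(3)] by (auto simp: lift_simps)
  ultimately have "inv_into (?X - ?E) (proj c) (proj c (lift c d p l \<Phi> z)) = lift c d p l \<Phi> z"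
    by (rule inv_into_f_f)
  then show "restrict (lift c d p l \<Phi>) ?X z =
      inv_into (?X - ?E) (proj c) (shear l \<Phi> 1 (proj c z))"
    using z by (simp add: proj_lift[OF \<Phi>])
qed

lemma lift_in_G_hat:
  assumes "polynomial_fun p" "shear_data l \<Phi>" "c \<noteq> d"
  shows "restrict (lift c d p l \<Phi>) (hypersurface p) \<in> G_hat p"
proof -
  have proj: "proj 1 = \<sigma>\<^sub>1" "proj 0 = \<sigma>\<^sub>2"
    by (simp_all add: fun_eq_iff proj_def \<sigma>\<^sub>1_def \<sigma>\<^sub>2_def)
  have "restrict (lift c d p l \<Phi>) (hypersurface p) \<in> G1_hat p \<union> G2_hat p"
    using is_lift_lift[OF assms] shear_in_G_group[OF assms(2), of 1 p] two_cases[of 0 1 c]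
    by (auto simp: G1_hat_def G2_hat_def U0_def V0_def proj)
  then show ?thesis unfolding G_hat_def by (rule generate.incl)
qed

section \<open>Transitivity\<close>

lemma G_hat_preserves:
  assumes "g \<in> G_hat p"
  shows "g \<in> Bij (hypersurface p)"
    "bij_betw g (hypersurface p - sing (hypersurface p)) (hypersurface p - sing (hypersurface p))"
proof -
  have "G1_hat p \<union> G2_hat p \<subseteq> Aut (hypersurface p)"
    by (auto simp: G1_hat_def G2_hat_def is_lift_def)
  then show "g \<in> Bij (hypersurface p)"
    "bij_betw g (hypersurface p - sing (hypersurface p)) (hypersurface p - sing (hypersurface p))"
    using generate_Aut_preserves generate_Aut_bij_betw_nonsing assms unfolding G_hat_def by blast+
qed

lemma G_hat_compose:
  assumes "g \<in> G_hat p" "h \<in> G_hat p"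
  obtains f where "f \<in> G_hat p" "\<And>z. z \<in> hypersurface p \<Longrightarrow> f z = g (h z)"
proof
  show "g \<otimes>\<^bsub>BijGroup (hypersurface p)\<^esub> h \<in> G_hat p"
    using assms unfolding G_hat_def by (rule generate.eng)
  show "(g \<otimes>\<^bsub>BijGroup (hypersurface p)\<^esub> h) z = g (h z)" if "z \<in> hypersurface p" for z
    using that G_hat_preserves(1)[OF assms(1)] G_hat_preserves(1)[OF assms(2)]
    by (simp add: BijGroup_def compose_eq)
qed

lemma G_hat_inverse:
  assumes "g \<in> G_hat p"
  obtains f where "f \<in> G_hat p" "\<And>z. z \<in> hypersurface p \<Longrightarrow> f (g z) = z"
proof
  let ?B = "BijGroup (hypersurface p)"
  interpret group ?B by (rule group_BijGroup)
  have H: "G1_hat p \<union> G2_hat p \<subseteq> carrier ?B"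
    by (auto simp: G1_hat_def G2_hat_def is_lift_def BijGroup_def Aut_def)
  show "inv\<^bsub>?B\<^esub> g \<in> G_hat p"
    using generate_m_inv_closed[OF H] assms unfolding G_hat_def by blast
  show "(inv\<^bsub>?B\<^esub> g) (g z) = z" if "z \<in> hypersurface p" for z
  proof -
    have g: "bij_betw g (hypersurface p) (hypersurface p)" "g \<in> Bij (hypersurface p)"
      using G_hat_preserves(1)[OF assms] by (auto simp: Bij_def)
    then show ?thesis
      using that bij_betw_apply[OF g(1) that] bij_betw_inv_into_left[OF g(1) that]
      by (simp add: inv_BijGroup)
  qed
qed

text \<open>Indexed families replace tuples. The points must lie on the hypersurface because group
  elements are controlled only there; the relation is then symmetric and transitive.\<close>

definition joined ::
    "(complex ^ 'k \<Rightarrow> complex) \<Rightarrow> 'i set \<Rightarrow> ('i \<Rightarrow> complex ^ ('k + 2)) \<Rightarrow>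
     ('i \<Rightarrow> complex ^ ('k + 2)) \<Rightarrow> bool" where
  "joined p I Q R \<longleftrightarrow> Q ` I \<subseteq> hypersurface p \<and> (\<exists>g\<in>G_hat p. \<forall>i\<in>I. g (Q i) = R i)"

lemma joined_trans:
  assumes "joined p I Q R" "joined p I R S"
  shows "joined p I Q S"
proof -
  obtain g h where g: "g \<in> G_hat p" "\<forall>i\<in>I. g (Q i) = R i" and h: "h \<in> G_hat p" "\<forall>i\<in>I. h (R i) = S i"
    using assms unfolding joined_def by blast
  obtain f where "f \<in> G_hat p" "\<And>z. z \<in> hypersurface p \<Longrightarrow> f z = h (g z)"
    using G_hat_compose[OF h(1) g(1)] by blast
  then show ?thesis using assms(1) g h unfolding joined_def by (metis image_subset_iff)
qed

lemma joined_sym: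
  assumes "joined p I Q R"
  shows "joined p I R Q"
proof -
  obtain g where g: "g \<in> G_hat p" "\<forall>i\<in>I. g (Q i) = R i" "Q ` I \<subseteq> hypersurface p"
    using assms unfolding joined_def by blast
  obtain f where f: "f \<in> G_hat p" "\<And>z. z \<in> hypersurface p \<Longrightarrow> f (g z) = z"
    using G_hat_inverse[OF g(1)] by blast
  have "R i \<in> hypersurface p" if "i \<in> I" for i
    using that g G_hat_preserves(1)[OF g(1)] by (metis Bij_imp_funcset PiE image_subset_iff)
  moreover have "f (R i) = Q i" if "i \<in> I" for i
    using that g f(2) by (metis image_subset_iff)
  ultimately show ?thesis using f(1) unfolding joined_def by blast
qed

text \<open>As \<open>l\<close> separates the sources, interpolation prescribes
  \<open>\<Phi>\<close> freely at each of them; as \<open>l\<close> vanishes on the displacements,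
  the interpolated \<open>\<Phi>\<close> stays in its kernel.\<close>

lemma joined_by_one_shear:
  fixes Q R :: "'i \<Rightarrow> complex ^ ('k::finite + 2)"
  assumes p: "polynomial_fun p" and cd: "c \<noteq> d" and I: "finite I"
    and Q: "\<And>i. i \<in> I \<Longrightarrow> Q i \<in> hypersurface p" "\<And>i. i \<in> I \<Longrightarrow> Q i $ Inr c \<noteq> 0"
    and R: "\<And>i. i \<in> I \<Longrightarrow> R i \<in> hypersurface p" "\<And>i. i \<in> I \<Longrightarrow> R i $ Inr c = Q i $ Inr c"
    and inj: "inj_on (\<lambda>i. linear_form l (proj c (Q i))) I"
    and l: "\<And>i. i \<in> I \<Longrightarrow> linear_form l (proj c (R i)) = linear_form l (proj c (Q i))"
  shows "joined p I Q R"
proof -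
  define s where "s i = linear_form l (proj c (Q i))" for i
  \<comment> \<open>Division by the coordinate \<open>c\<close> cancels the factor that a shear puts
    on \<open>\<Phi>\<close>.\<close>
  define a where "a i = (1 / Q i $ Inr c) *s (proj c (R i) - proj c (Q i))" for i
  have "\<forall>i\<in>I. \<exists>P. \<forall>j\<in>I. poly P (s j) = (if j = i then 1 else 0)"
    using lagrange_interpolation[OF I, of s] inj unfolding s_def by blast
  then obtain L where L: "\<And>i j. i \<in> I \<Longrightarrow> j \<in> I \<Longrightarrow> poly (L i) (s j) = (if j = i then 1 else 0)"
    by metis
  define \<Phi> where "\<Phi> t = (\<Sum>i\<in>I. poly (L i) t *s a i)" for t
  have \<Phi>_nth: "\<Phi> t $ j = (\<Sum>i\<in>I. poly (L i) t * a i $ j)" for t j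
    by (simp add: \<Phi>_def)
  have \<Phi>_s: "\<Phi> (s i) = a i" if "i \<in> I" for i
    using that I L by (simp add: vec_eq_iff \<Phi>_nth if_distrib[of "\<lambda>x. x * _"] cong: if_cong)
  have "shear_data l \<Phi>"
    unfolding shear_data_def
  proof (intro conjI allI)
    show "\<Phi> t $ Inr 1 = 0" for t
      unfolding \<Phi>_nth by (rule sum.neutral) (simp add: a_def R(2))
    have "linear_form l (a i) = 0" if "i \<in> I" for i
      using l[OF that] by (simp add: a_def linear_form_scale linear_form_diff)
    then show "linear_form l (\<Phi> t) = 0" for t
      by (simp add: \<Phi>_def linear_form_sum linear_form_scale)
    show "\<exists>P. \<forall>t. \<Phi> t $ j = poly P t" for j
      by (rule exI[of _ "\<Sum>i\<in>I. smult (a i $ j) (L i)"])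
        (simp add: \<Phi>_nth poly_sum mult.commute)
  qed
  note h = lift_in_G_hat[OF p this cd] proj_lift[OF this]
  have "lift c d p l \<Phi> (Q i) = R i" if i: "i \<in> I" for i
  proof (rule proj_inject[OF cd])
    show "lift c d p l \<Phi> (Q i) \<in> hypersurface p"
      by (rule lift_in_hypersurface[OF cd Q(1)[OF i]])
    show "R i \<in> hypersurface p" by (rule R(1)[OF i])
    show "lift c d p l \<Phi> (Q i) $ Inr c \<noteq> 0" using Q(2)[OF i] by (simp add: lift_simps)
    have "proj c (lift c d p l \<Phi> (Q i)) = proj c (Q i) + (Q i $ Inr c) *s a i"
      using \<Phi>_s[OF i] by (simp add: h(2) shear_def s_def)
    also have "\<dots> = proj c (R i)"
      using Q(2)[OF i] by (simp add: a_def vector_smult_assoc)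
    finally show "proj c (lift c d p l \<Phi> (Q i)) = proj c (R i)" .
  qed
  then show ?thesis
    using h(1) Q(1) unfolding joined_def
    by (intro conjI bexI[of _ "restrict (lift c d p l \<Phi>) (hypersurface p)"]) auto
qed

text \<open>Two shears meet at an intermediate family \<open>S\<close>: one starts from
  \<open>Q\<close> and has the invariant form \<open>l\<close>, the other starts from
  \<open>R\<close> and has the invariant form \<open>m\<close>.\<close>

lemma joined_in_level:
  fixes Q R :: "'i \<Rightarrow> complex ^ ('k::finite + 2)"
  assumes k: "CARD('k) \<ge> 2" and p: "polynomial_fun p" and cd: "c \<noteq> d" and I: "finite I"
    and Q: "\<And>i. i \<in> I \<Longrightarrow> Q i \<in> hypersurface p" "\<And>i. i \<in> I \<Longrightarrow> Q i $ Inr c \<noteq> 0" "inj_on Q I"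
    and R: "\<And>i. i \<in> I \<Longrightarrow> R i \<in> hypersurface p" "\<And>i. i \<in> I \<Longrightarrow> R i $ Inr c = Q i $ Inr c" "inj_on R I"
  shows "joined p I Q R"
proof -
  have inj: "inj_on (\<lambda>i. proj c (S i)) I"
    if "\<And>i. i \<in> I \<Longrightarrow> S i \<in> hypersurface p" "\<And>i. i \<in> I \<Longrightarrow> S i $ Inr c \<noteq> 0" "inj_on S I" for S
  proof (rule inj_onI)
    fix i j assume ij: "i \<in> I" "j \<in> I" "proj c (S i) = proj c (S j)"
    then have "S i = S j" using that by (intro proj_inject[OF cd])
    then show "i = j" using ij that(3) by (blast dest: inj_onD)
  qed
  have inj_Q: "inj_on (\<lambda>i. proj c (Q i)) I" and inj_R: "inj_on (\<lambda>i. proj c (R i)) I"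
    using Q R by (auto intro!: inj)
  obtain i0 j0 :: 'k where ij: "j0 \<noteq> i0"
    using exists_other_index[OF k] by blast
  obtain l :: "complex ^ ('k + 1)"
    where l: "inj_on (\<lambda>i. linear_form l (proj c (Q i))) I" "linear_form l (axis (Inl i0) 1) \<noteq> 0"
    using exists_separating_linear_form[OF I inj_Q, of "axis (Inl i0) 1"] by (auto simp: axis_eq_0_iff)
  \<comment> \<open>A nonzero vector in the kernel of \<open>l\<close> without last component. The
    two base directions \<open>i0\<close> and \<open>j0\<close> provide it, \<open>l\<close> being
    nonzero on the first.\<close>
  define e :: "complex ^ ('k + 1)" where
    "e = axis (Inl j0) 1 - (l $ Inl j0 / l $ Inl i0) *s axis (Inl i0) 1"
  have "e $ Inl j0 = 1" and e1: "e $ Inr 1 = 0"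
    using ij by (simp_all add: e_def axis_def)
  moreover have le: "linear_form l e = 0"
    using l(2) by (simp add: e_def linear_form_diff linear_form_scale linear_form_axis)
  ultimately have "e \<noteq> 0" by auto
  then obtain m :: "complex ^ ('k + 1)"
    where m: "inj_on (\<lambda>i. linear_form m (proj c (R i))) I" "linear_form m e \<noteq> 0"
    using exists_separating_linear_form[OF I inj_R] by blast
  \<comment> \<open>Moving along \<open>e\<close> keeps \<open>l\<close> at its value on the source
    and, by the chosen coefficient, brings \<open>m\<close> to its value on the target.\<close>
  define y where "y i = proj c (Q i) +
    ((linear_form m (proj c (R i)) - linear_form m (proj c (Q i))) / linear_form m e) *s e" for i
  define S where "S i = hpoint c (base (y i)) (Q i $ Inr c) (p (base (y i)) / Q i $ Inr c)" for i
  have S: "S i \<in> hypersurface p" "S i $ Inr c = Q i $ Inr c" "proj c (S i) = y i" if "i \<in> I" for i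
    using Q(2)[OF that] cd
    by (auto simp: S_def mem_hypersurface_iff[OF cd] y_def e1 intro!: append_coord_eqI)
  have "joined p I Q S"
    by (rule joined_by_one_shear[OF p cd I, where l = l])
      (use Q S l in \<open>simp_all add: y_def linear_form_add linear_form_scale le\<close>)
  moreover have "joined p I R S"
    by (rule joined_by_one_shear[OF p cd I, where l = m])
      (use Q R S m in \<open>simp_all add: y_def linear_form_add linear_form_scale\<close>)
  ultimately show ?thesis using joined_trans joined_sym by blast
qed

section \<open>Moving nonsingular points off a divisor\<close>

lemma shear_data_const:
  assumes "w $ Inr 1 = 0"
  shows "shear_data 0 (\<lambda>s. w)"
proof -
  have "\<exists>P. \<forall>s. w $ j = poly P s" for j by (rule exI[of _ "[:w $ j:]"]) simp
  then show ?thesis using assms by (simp add: shear_data_def linear_form_def)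
qed

text \<open>If the coordinate \<open>d\<close> vanishes at \<open>z\<close>, there are two cases:
  when \<open>c\<close> vanishes too, nonsingularity gives a direction of nonzero derivative of
  \<open>p\<close>; otherwise the base point can be translated to \<open>y\<close>. The shape
  \<open>t *s w\<close> prepares the variation of \<open>t\<close> for fixed
  \<open>w\<close>.\<close>

lemma exists_translation_off_divisor:
  fixes p :: "complex ^ 'k::finite \<Rightarrow> complex"
  assumes p: "polynomial_fun p" "p y \<noteq> 0" and cd: "c \<noteq> d"
    and z: "z \<in> hypersurface p" "z \<notin> sing (hypersurface p)"
  shows "\<exists>w t. z $ Inr d + difference_quotient p (base z) (t *s w) (z $ Inr c) \<noteq> 0"
proof (cases "z $ Inr d = 0")
  case False
  then have "z $ Inr d + difference_quotient p (base z) (0 *s 0) (z $ Inr c) \<noteq> 0"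
    by (simp add: difference_quotient_def linear_form_zero)
  then show ?thesis by blast
next
  case d: True
  show ?thesis
  proof (cases "z $ Inr c = 0")
    case True
    then have "gradient p (base z) \<noteq> 0"
      using critical_point_in_sing[OF p(1) _ z(1) cd] d z(2) by blast
    then obtain i where "gradient p (base z) $ i \<noteq> 0" by (auto simp: vec_eq_iff)
    then have "z $ Inr d + difference_quotient p (base z) (1 *s axis i 1) (z $ Inr c) \<noteq> 0"
      using True d by (simp add: difference_quotient_def linear_form_axis)
    then show ?thesis by blast
  next
    case False
    have "p (base z) = 0" using z(1) d by (simp add: mem_hypersurface_iff[OF cd])
    moreover have "base z + z $ Inr c *s ((1 / z $ Inr c) *s (y - base z)) = y"
      using False by (simp add: vector_smult_assoc)
    ultimately have "z $ Inr d +
        difference_quotient p (base z) ((1 / z $ Inr c) *s (y - base z)) (z $ Inr c) \<noteq> 0"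
      using False d p(2) by (simp add: difference_quotient_def)
    then show ?thesis by blast
  qed
qed

text \<open>Points are added one at a time: a generic multiple of the direction found for the new
  point preserves the inequalities already gained.\<close>

lemma move_off_divisor:
  fixes p :: "complex ^ 'k::finite \<Rightarrow> complex"
  assumes p: "polynomial_fun p" "p y \<noteq> 0" and cd: "c \<noteq> d" and I: "finite I"
    and Q: "\<And>i. i \<in> I \<Longrightarrow> Q i \<in> hypersurface p - sing (hypersurface p)"
  shows "\<exists>g\<in>G_hat p. \<forall>i\<in>I. g (Q i) $ Inr d \<noteq> 0"
  using I Q
proof induction
  case empty
  show ?case unfolding G_hat_def using generate.one by blast
next
  case (insert n I)
  then obtain g where g: "g \<in> G_hat p" "\<forall>i\<in>I. g (Q i) $ Inr d \<noteq> 0" by auto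
  define R where "R i = g (Q i)" for i
  have R: "R i \<in> hypersurface p - sing (hypersurface p)" if "i \<in> insert n I" for i
    unfolding R_def using bij_betw_apply[OF G_hat_preserves(2)[OF g(1)]] insert.prems that by blast
  obtain w t where wt:
    "R n $ Inr d + difference_quotient p (base (R n)) (t *s w) (R n $ Inr c) \<noteq> 0"
    using exists_translation_off_divisor[OF p cd, of "R n"] R by blast
  have "\<forall>i. \<exists>P. \<forall>t. difference_quotient p (base (R i)) (t *s w) (R i $ Inr c) = poly P t"
    using polynomial_curve_difference_quotient[OF p(1)] by blast
  then obtain P where P:
    "\<And>i t. difference_quotient p (base (R i)) (t *s w) (R i $ Inr c) = poly (P i) t"
    by metis
  \<comment> \<open>\<open>A i\<close> is the coordinate \<open>d\<close> of the moved point as a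
    polynomial in the time parameter. It is nonzero at \<open>0\<close> for the earlier points and
    at the \<open>t\<close> found above for the new one.\<close>
  define A where "A i = [:R i $ Inr d:] + P i" for i
  have A: "poly (A i) t = R i $ Inr d + difference_quotient p (base (R i)) (t *s w) (R i $ Inr c)"
    for i t by (simp add: A_def P)
  have "A i \<noteq> 0" if "i \<in> insert n I" for i
  proof (cases "i = n")
    case True
    then show ?thesis using wt A[of n t] by auto
  next
    case False
    then have "poly (A i) 0 \<noteq> 0"
      using g(2) that unfolding A
      by (simp add: R_def difference_quotient_def linear_form_zero)
    then show ?thesis by auto
  qed
  then obtain r where r: "\<forall>i\<in>insert n I. poly (A i) r \<noteq> 0"
    using exists_common_nonroot[of "insert n I" A] insert.hyps by blast
  let ?\<Phi> = "\<lambda>s. append_coord (r *s w) 0"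
  have "restrict (lift c d p 0 ?\<Phi>) (hypersurface p) \<in> G_hat p"
    by (rule lift_in_G_hat[OF p(1) shear_data_const cd]) simp
  then obtain f where f: "f \<in> G_hat p"
    "\<And>z. z \<in> hypersurface p \<Longrightarrow> f z = restrict (lift c d p 0 ?\<Phi>) (hypersurface p) (g z)"
    using G_hat_compose g(1) by blast
  have "f (Q i) $ Inr d \<noteq> 0" if "i \<in> insert n I" for i
  proof -
    have "f (Q i) = lift c d p 0 ?\<Phi> (R i)"
      using f(2) R[OF that] insert.prems[OF that] by (simp add: R_def)
    then show ?thesis using bspec[OF r that] cd by (simp add: A lift_simps)
  qed
  then show ?case using f(1) by blast
qed

lemma joined_nonsingular:
  fixes p :: "complex ^ 'k::finite \<Rightarrow> complex"
  assumes k: "CARD('k) \<ge> 2" and p: "polynomial_fun p" "\<not> (\<exists>c. \<forall>x. p x = c)" and I: "finite I"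
    and Q: "\<And>i. i \<in> I \<Longrightarrow> Q i \<in> hypersurface p - sing (hypersurface p)" "inj_on Q I"
    and R: "\<And>i. i \<in> I \<Longrightarrow> R i \<in> hypersurface p - sing (hypersurface p)" "inj_on R I"
  shows "joined p I Q R"
proof -
  let ?X = "hypersurface p"
  have two: "(0 :: 2) \<noteq> 1" by simp
  obtain x y where xy: "p x \<noteq> p y" using p(2) by metis
  obtain y0 where y0: "p y0 \<noteq> 0" using p(2) by blast
  \<comment> \<open>The family \<open>Q\<close> is moved off \<open>v = 0\<close>, and
    \<open>R\<close> off \<open>u = 0\<close>.\<close>
  obtain g where g: "g \<in> G_hat p" "\<forall>i\<in>I. g (Q i) $ Inr 1 \<noteq> 0"
    using move_off_divisor[OF p(1) y0 two I, of Q] Q(1) by blast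
  obtain h where h: "h \<in> G_hat p" "\<forall>i\<in>I. h (R i) $ Inr 0 \<noteq> 0"
    using move_off_divisor[OF p(1) y0 two[symmetric] I, of R] R(1) by blast
  define A where "A i = g (Q i)" for i
  define B where "B i = h (R i)" for i
  have gh: "bij_betw g ?X ?X" "bij_betw h ?X ?X"
    using G_hat_preserves(1) g(1) h(1) by (auto simp: Bij_def)
  have A: "\<And>i. i \<in> I \<Longrightarrow> A i \<in> ?X" "\<And>i. i \<in> I \<Longrightarrow> A i $ Inr 1 \<noteq> 0" "inj_on A I"
    using Q g(2) bij_betw_apply[OF gh(1)] bij_betw_imp_inj_on[OF gh(1)]
    by (auto simp: A_def inj_on_def)
  have B: "\<And>i. i \<in> I \<Longrightarrow> B i \<in> ?X" "\<And>i. i \<in> I \<Longrightarrow> B i $ Inr 0 \<noteq> 0" "inj_on B I"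
    using R h(2) bij_betw_apply[OF gh(2)] bij_betw_imp_inj_on[OF gh(2)]
    by (auto simp: B_def inj_on_def)
  \<comment> \<open>Distinct base points in these fibres make \<open>M\<close> a family of distinct
    points of the hypersurface with \<open>v\<close> taken from \<open>A\<close> and
    \<open>u\<close> from \<open>B\<close>.\<close>
  obtain b where b: "inj_on b I" "\<forall>i\<in>I. b i \<in> {x. p x = A i $ Inr 1 * B i $ Inr 0}"
    using exists_injective_choice[OF I, of "\<lambda>i. {x. p x = A i $ Inr 1 * B i $ Inr 0}"]
      infinite_fibre[OF k p(1) xy] by blast
  define M where "M i = hpoint 1 (b i) (A i $ Inr 1) (B i $ Inr 0)" for i
  have M: "\<And>i. i \<in> I \<Longrightarrow> M i \<in> ?X" "\<And>i. M i $ Inr 1 = A i $ Inr 1" "\<And>i. M i $ Inr 0 = B i $ Inr 0"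
    using b(2) by (auto simp: M_def mem_hypersurface_iff[OF two[symmetric]])
  have inj_M: "inj_on M I"
    using b(1) by (auto simp: inj_on_def M_def dest: arg_cong[of _ _ base])
  have "joined p I A M"
    using joined_in_level[OF k p(1) two[symmetric] I A M(1,2) inj_M] by blast
  moreover have "joined p I B M"
    using joined_in_level[OF k p(1) two I B M(1,3) inj_M] by blast
  moreover have "joined p I Q A" "joined p I R B"
    using Q(1) R(1) g(1) h(1) by (auto simp: joined_def A_def B_def)
  ultimately show ?thesis using joined_trans joined_sym by blast
qed

theorem theorem5p1:
  fixes p :: "complex ^ 'k::finite \<Rightarrow> complex"
  assumes "CARD('k) \<ge> 2"
    and "polynomial_fun p"
    and "\<not> (\<exists>c. \<forall>x. p x = c)"
  shows "\<forall>m. acts_m_transitively m (G_hat p) (hypersurface p - sing (hypersurface p))"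
  unfolding acts_m_transitively_def
proof (intro allI conjI ballI impI)
  fix m g
  assume "g \<in> G_hat p"
  then show "bij_betw g (hypersurface p - sing (hypersurface p)) (hypersurface p - sing (hypersurface p))"
    by (rule G_hat_preserves)
next
  fix m and xs ys :: "(complex ^ ('k + 2)) list"
  assume *: "length xs = m \<and> length ys = m \<and> distinct xs \<and> distinct ys \<and>
    set xs \<subseteq> hypersurface p - sing (hypersurface p) \<and>
    set ys \<subseteq> hypersurface p - sing (hypersurface p)"
  \<comment> \<open>A list is read as a family indexed by its positions, which distinctness makes
    injective.\<close>
  have "joined p {..<m} ((!) xs) ((!) ys)"
    using * nth_mem[of _ xs] nth_mem[of _ ys]
    by (intro joined_nonsingular[OF assms]) (auto simp: inj_on_def nth_eq_iff_index_eq subset_iff)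
  then obtain g where "g \<in> G_hat p" "\<forall>i<m. g (xs ! i) = ys ! i"
    unfolding joined_def by auto
  then show "\<exists>g\<in>G_hat p. map g xs = ys"
    using * by (intro bexI[of _ g] nth_equalityI) auto
qed

end
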